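(* Let $X$ be a Banach space, let $E$ be a subspace of $X$, and suppose a net $(C_\alpha)$ of closed convex subsets of $E$ converges Wijsman but not slice (respectively, not Mosco) to a closed convex set $C$ in $E$. Then there are a separable subspace $Y$ of $E$ and a sequence of indices $\alpha_1\le\alpha_2\le\cdots$ such that the sequence $(C_{\alpha_n}\cap Y)_{n}$ converges Wijsman but not slice (respectively, not Mosco) to $C\cap Y$ as subsets of $Y$.
   Context: Banach spaces are real and $X$ is infinite dimensional. "Subspace" means closed linear subspace, endowed with the restriction of the given norm. $d(x,A)=\inf\{\|x-a\|:a\in A\}$ and $d(A,B)=\inf\{\|a-b\|:a\in A,b\in B\}$, with value $\infty$ if a set involved is empty. For closed convex subsets $C_\alpha$ (a net), $C$ of a Banach space $Y$: - $C_\alpha$ converges Wijsman to $C$ in $Y$ if $\lim_\alpha d(y,C_\alpha)=d(y,C)$ for all $y\in Y$; - $C_\alpha$ converges slice to $C$ in $Y$ if $\lim_\alpha d(W,C_\alpha)=d(W,C)$ for all closed bounded convex $W\subset Y$; - $C_\alpha$ converges Mosco to $C$ in $Y$ if (M(i)) $d(y,C_\alpha)\to0$ for every $y\in C$, and (M(ii)) whenever $y_{\alpha_\beta}\in C_{\alpha_\beta}$ for some subnet, $\{y_{\alpha_\beta}\}_\beta$ is relatively weakly compact and $y_{\alpha_\beta}\to y$ weakly, then $y\in C$. *)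

theory Defs
  imports "HOL-Analysis.Analysis"
begin

section \<open>Nets and subnets\<close>

definition directed_set :: "'i set \<Rightarrow> ('i \<Rightarrow> 'i \<Rightarrow> bool) \<Rightarrow> bool" where
  "directed_set D le \<longleftrightarrow> D \<noteq> {} \<and> (\<forall>a\<in>D. le a a) \<and>
     (\<forall>a\<in>D. \<forall>b\<in>D. \<forall>c\<in>D. le a b \<longrightarrow> le b c \<longrightarrow> le a c) \<and>
     (\<forall>a\<in>D. \<forall>b\<in>D. \<exists>c\<in>D. le a c \<and> le b c)"

text \<open>The filter of tails: limits of nets are limits along it (see \<open>eventually_net_filter\<close>).\<close>

definition net_filter :: "'i set \<Rightarrow> ('i \<Rightarrow> 'i \<Rightarrow> bool) \<Rightarrow> 'i filter" where
  "net_filter D le = (INF a\<in>D. principal {b\<in>D. le a b})"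

text \<open>Subnets in the sense of Kelley: \<open>\<phi>\<close> need not be monotone.\<close>

definition subnet_map ::
  "'b set \<Rightarrow> ('b \<Rightarrow> 'b \<Rightarrow> bool) \<Rightarrow> ('b \<Rightarrow> 'i) \<Rightarrow> 'i set \<Rightarrow> ('i \<Rightarrow> 'i \<Rightarrow> bool) \<Rightarrow> bool" where
  "subnet_map B leB \<phi> D le \<longleftrightarrow> directed_set B leB \<and> \<phi> ` B \<subseteq> D \<and>
     (\<forall>a\<in>D. \<exists>b0\<in>B. \<forall>b\<in>B. leB b0 b \<longrightarrow> le a (\<phi> b))"

lemma eventually_net_filter:
  assumes "directed_set D le"
  shows "eventually P (net_filter D le) \<longleftrightarrow> (\<exists>a\<in>D. \<forall>b\<in>D. le a b \<longrightarrow> P b)"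
proof -
  have "eventually P (net_filter D le) \<longleftrightarrow>
      (\<exists>a\<in>D. eventually P (principal {b\<in>D. le a b}))"
    unfolding net_filter_def
  proof (rule eventually_INF_base)
    show "D \<noteq> {}" using assms by (simp add: directed_set_def)
    fix a b assume ab: "a \<in> D" "b \<in> D"
    then obtain c where c: "c \<in> D" "le a c" "le b c"
      using assms unfolding directed_set_def by meson
    have "{x\<in>D. le c x} \<subseteq> {x\<in>D. le a x} \<inter> {x\<in>D. le b x}"
      using assms ab c unfolding directed_set_def by blast
    then show "\<exists>x\<in>D. principal {b \<in> D. le x b} \<le>
        inf (principal {b \<in> D. le a b}) (principal {c \<in> D. le b c})"
      using c(1) by auto
  qed
  then show ?thesis by (auto simp: eventually_principal)
qed

lemma directed_set_nat: "directed_set (UNIV :: nat set) (\<le>)"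
  by (auto simp: directed_set_def intro: le_trans max.cobounded1 max.cobounded2)

lemma net_filter_nat: "net_filter (UNIV :: nat set) (\<le>) = sequentially"
  by (simp add: net_filter_def at_top_def atLeast_def)

section \<open>Distances with values in the extended reals\<close>

text \<open>Unlike \<^const>\<open>infdist\<close> and \<^const>\<open>setdist\<close>, these are \<open>\<infinity>\<close> when a set involved is empty.\<close>

definition edist :: "'a::metric_space \<Rightarrow> 'a set \<Rightarrow> ereal" where
  "edist x A = (INF a\<in>A. ereal (dist x a))"

definition esetdist :: "'a::metric_space set \<Rightarrow> 'a set \<Rightarrow> ereal" where
  "esetdist A B = (INF a\<in>A. INF b\<in>B. ereal (dist a b))"

section \<open>The weak topology of a closed subspace\<close>

text \<open>Functionals are only constrained on \<open>Y\<close>; their values off \<open>Y\<close> are irrelevant.\<close>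

definition dual_on :: "'a::real_normed_vector set \<Rightarrow> ('a \<Rightarrow> real) set" where
  "dual_on Y = {f. (\<forall>x\<in>Y. \<forall>y\<in>Y. f (x + y) = f x + f y) \<and>
                   (\<forall>c. \<forall>x\<in>Y. f (c *\<^sub>R x) = c * f x) \<and>
                   (\<exists>K. \<forall>x\<in>Y. \<bar>f x\<bar> \<le> K * norm x)}"

definition weak_topology :: "'a::real_normed_vector set \<Rightarrow> 'a topology" where
  "weak_topology Y = topology_generated_by {{x\<in>Y. f x \<in> U} | f U. f \<in> dual_on Y \<and> open U}"

lemma topspace_weak_topology: "topspace (weak_topology Y) = Y"
proof -
  have "(\<lambda>_. 0) \<in> dual_on Y" by (auto simp: dual_on_def intro: exI[of _ 0])
  then have "{x\<in>Y. (0::real) \<in> UNIV} \<in> {{x\<in>Y. f x \<in> U} | f U. f \<in> dual_on Y \<and> open U}"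
    by blast
  then show ?thesis
    unfolding weak_topology_def topology_generated_by_topspace by auto
qed

definition relatively_weakly_compact :: "'a::real_normed_vector set \<Rightarrow> 'a set \<Rightarrow> bool" where
  "relatively_weakly_compact Y S \<longleftrightarrow>
     S \<subseteq> Y \<and> compactin (weak_topology Y) (weak_topology Y closure_of S)"

section \<open>Convergence of nets of sets in a closed subspace Y\<close>

definition wijsman_conv ::
  "'a::real_normed_vector set \<Rightarrow> 'i set \<Rightarrow> ('i \<Rightarrow> 'i \<Rightarrow> bool) \<Rightarrow> ('i \<Rightarrow> 'a set) \<Rightarrow> 'a set \<Rightarrow> bool" where
  "wijsman_conv Y D le C L \<longleftrightarrow>
     (\<forall>y\<in>Y. ((\<lambda>a. edist y (C a)) \<longlongrightarrow> edist y L) (net_filter D le))"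

definition slice_conv ::
  "'a::real_normed_vector set \<Rightarrow> 'i set \<Rightarrow> ('i \<Rightarrow> 'i \<Rightarrow> bool) \<Rightarrow> ('i \<Rightarrow> 'a set) \<Rightarrow> 'a set \<Rightarrow> bool" where
  "slice_conv Y D le C L \<longleftrightarrow>
     (\<forall>W. W \<subseteq> Y \<and> closed W \<and> bounded W \<and> convex W \<longrightarrow>
        ((\<lambda>a. esetdist W (C a)) \<longlongrightarrow> esetdist W L) (net_filter D le))"

definition mosco_i ::
  "'i set \<Rightarrow> ('i \<Rightarrow> 'i \<Rightarrow> bool) \<Rightarrow> ('i \<Rightarrow> 'a::real_normed_vector set) \<Rightarrow> 'a set \<Rightarrow> bool" where
  "mosco_i D le C L \<longleftrightarrow> (\<forall>y\<in>L. ((\<lambda>a. edist y (C a)) \<longlongrightarrow> 0) (net_filter D le))"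

text \<open>The type argument is the type from which the index sets of the subnets are taken.\<close>

definition mosco_ii ::
  "'b itself \<Rightarrow> 'a::real_normed_vector set \<Rightarrow> 'i set \<Rightarrow> ('i \<Rightarrow> 'i \<Rightarrow> bool) \<Rightarrow> ('i \<Rightarrow> 'a set) \<Rightarrow> 'a set \<Rightarrow> bool" where
  "mosco_ii T Y D le C L \<longleftrightarrow>
     (\<forall>(B :: 'b set) leB \<phi> y l.
        subnet_map B leB \<phi> D le \<and> (\<forall>b\<in>B. y b \<in> C (\<phi> b)) \<and>
        relatively_weakly_compact Y (y ` B) \<and>
        limitin (weak_topology Y) y l (net_filter B leB)
        \<longrightarrow> l \<in> L)"

text \<open>
  HOL cannot quantify over all index types inside a formula. The type chosen here is large
  enough to index every subnet up to equality of tails, so that this instance of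
  \<^const>\<open>mosco_ii\<close> implies the instance for any other type; see \<open>mosco_ii_any_index_type\<close>.
\<close>

definition mosco_conv ::
  "'a::real_normed_vector set \<Rightarrow> 'i set \<Rightarrow> ('i \<Rightarrow> 'i \<Rightarrow> bool) \<Rightarrow> ('i \<Rightarrow> 'a set) \<Rightarrow> 'a set \<Rightarrow> bool" where
  "mosco_conv Y D le C L \<longleftrightarrow>
     mosco_i D le C L \<and> mosco_ii TYPE(('i \<times> 'a) \<times> ('i \<times> 'a) set) Y D le C L"

lemma mosco_ii_any_index_type:
  fixes C :: "'i \<Rightarrow> 'a::real_normed_vector set"
  assumes M: "mosco_ii TYPE(('i \<times> 'a) \<times> ('i \<times> 'a) set) Y D le C L"
  shows "mosco_ii TYPE('b) Y D le C L"
  unfolding mosco_ii_def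
proof (intro allI impI, elim conjE)
  fix B :: "'b set" and leB \<phi> y l
  assume sub: "subnet_map B leB \<phi> D le" and yC: "\<forall>b\<in>B. y b \<in> C (\<phi> b)"
    and rwc: "relatively_weakly_compact Y (y ` B)"
    and lim: "limitin (weak_topology Y) y l (net_filter B leB)"
  have dir: "directed_set B leB" using sub by (simp add: subnet_map_def)
  have refl: "leB b b" if "b \<in> B" for b using dir that by (simp add: directed_set_def)
  have trans: "leB a c" if "leB a b" "leB b c" "a \<in> B" "b \<in> B" "c \<in> B" for a b c
    using dir that unfolding directed_set_def by blast
  have up: "\<exists>c\<in>B. leB a c \<and> leB b c" if "a \<in> B" "b \<in> B" for a b
    using dir that unfolding directed_set_def by blast
  define T where "T b = {(\<phi> c, y c) | c. c \<in> B \<and> leB b c}" for b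
  define B' where "B' = {(p, T b) | p b. b \<in> B \<and> p \<in> T b}"
  define le' where "le' u v \<longleftrightarrow> snd v \<subseteq> snd u" for u v :: "('i \<times> 'a) \<times> ('i \<times> 'a) set"
  define \<phi>' where "\<phi>' u = fst (fst u)" for u :: "('i \<times> 'a) \<times> ('i \<times> 'a) set"
  define y' where "y' u = snd (fst u)" for u :: "('i \<times> 'a) \<times> ('i \<times> 'a) set"
  have mem: "((\<phi> b, y b), T b) \<in> B'" if "b \<in> B" for b
    using that refl unfolding B'_def T_def by blast
  have Tmono: "T b \<subseteq> T a" if "leB a b" "a \<in> B" "b \<in> B" for a b
    using that trans unfolding T_def by blast
  have B'E: "\<exists>c\<in>B. fst u = (\<phi> c, y c) \<and> (\<exists>b\<in>B. leB b c \<and> snd u = T b)" if "u \<in> B'" for u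
    using that unfolding B'_def T_def by force
  have above: "\<exists>c\<in>B. leB b c \<and> \<phi>' u = \<phi> c \<and> y' u = y c"
    if u: "u \<in> B'" "le' ((\<phi> b, y b), T b) u" "b \<in> B" for u b
  proof -
    have "fst u \<in> T b" using u unfolding B'_def le'_def by auto
    then show ?thesis unfolding T_def \<phi>'_def y'_def by auto
  qed
  have dir': "directed_set B' le'"
    unfolding directed_set_def
  proof (intro conjI ballI impI)
    show "B' \<noteq> {}" using mem dir by (force simp: directed_set_def)
  next
    fix u v assume "u \<in> B'" "v \<in> B'"
    then obtain a b where ab: "a \<in> B" "b \<in> B" "snd u = T a" "snd v = T b"
      using B'E by meson
    then obtain c where c: "c \<in> B" "leB a c" "leB b c" using up by blast
    then show "\<exists>w\<in>B'. le' u w \<and> le' v w"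
      using ab Tmono mem unfolding le'_def by (metis snd_conv)
  qed (auto simp: le'_def)
  have "subnet_map B' le' \<phi>' D le"
    unfolding subnet_map_def
  proof (intro conjI ballI)
    show "\<phi>' ` B' \<subseteq> D"
      using sub B'E unfolding subnet_map_def \<phi>'_def by force
    fix a assume "a \<in> D"
    then obtain b0 where b0: "b0 \<in> B" "\<forall>b\<in>B. leB b0 b \<longrightarrow> le a (\<phi> b)"
      using sub unfolding subnet_map_def by blast
    show "\<exists>b0\<in>B'. \<forall>b\<in>B'. le' b0 b \<longrightarrow> le a (\<phi>' b)"
      using above b0 mem by metis
  qed (rule dir')
  moreover have "\<forall>u\<in>B'. y' u \<in> C (\<phi>' u)"
    using yC B'E unfolding y'_def \<phi>'_def by force
  moreover have "y' ` B' = y ` B"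
  proof
    show "y' ` B' \<subseteq> y ` B" using B'E unfolding y'_def by force
    show "y ` B \<subseteq> y' ` B'" using mem unfolding y'_def by force
  qed
  moreover have "limitin (weak_topology Y) y' l (net_filter B' le')"
    unfolding limitin_def eventually_net_filter[OF dir']
  proof (intro conjI allI impI)
    show "l \<in> topspace (weak_topology Y)" using lim by (simp add: limitin_def)
    fix U assume "openin (weak_topology Y) U \<and> l \<in> U"
    then obtain b0 where b0: "b0 \<in> B" "\<forall>b\<in>B. leB b0 b \<longrightarrow> y b \<in> U"
      using lim unfolding limitin_def eventually_net_filter[OF dir] by blast
    show "\<exists>a\<in>B'. \<forall>b\<in>B'. le' a b \<longrightarrow> y' b \<in> U"
      using above b0 mem by metis
  qed
  ultimately show "l \<in> L"
    using M rwc unfolding mosco_ii_def by metis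
qed

section \<open>Subspaces\<close>

definition closed_subspace :: "'a::real_normed_vector set \<Rightarrow> bool" where
  "closed_subspace Y \<longleftrightarrow> subspace Y \<and> closed Y"

definition infinite_dimensional :: "'a::real_vector itself \<Rightarrow> bool" where
  "infinite_dimensional T \<longleftrightarrow> \<not> (\<exists>B :: 'a set. finite B \<and> span B = UNIV)"

end

theory Submission
  imports Defs
begin

text \<open>
  Failure of slice or Mosco convergence is witnessed, for cofinally many indices, by finitely many
  points.  A back-and-forth construction produces an increasing sequence of such indices and a
  separable subspace \<open>Y\<close> that contains the witnesses and enough points of the sets involved for the
  distances from points of \<open>Y\<close> to a set and to its trace on \<open>Y\<close> to agree.  This gives Wijsman
  convergence in \<open>Y\<close>, and for slice convergence the witnesses in \<open>Y\<close> settle the claim.  For Mosco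
  convergence, Hahn-Banach shows that the weak topology of \<open>Y\<close> is inherited from \<open>E\<close> and provides
  a functional that separates \<open>L\<close> from the weak limit; the witnesses \<open>y\<^sub>n\<close> are kept on the side of
  that limit, so their weak cluster points miss \<open>L\<close>.
\<close>

section \<open>The Hahn-Banach theorem\<close>

text \<open>Homogeneity is asked only as an inequality, so that it passes to infima; applying it to
  \<open>1/t\<close> gives equality for \<open>t > 0\<close>, and the case \<open>t = 2\<close> then
  gives \<open>q 0 = 0\<close>.\<close>

definition sublinear :: "('a::real_vector \<Rightarrow> real) \<Rightarrow> bool" where
  "sublinear q \<longleftrightarrow> (\<forall>x y. q (x + y) \<le> q x + q y) \<and> (\<forall>t x. t > 0 \<longrightarrow> q (t *\<^sub>R x) \<le> t * q x)"

lemma sublinear_add: "sublinear q \<Longrightarrow> q (x + y) \<le> q x + q y"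
  by (simp add: sublinear_def)

lemma sublinear_scaleR:
  assumes "sublinear q" "t > 0"
  shows "q (t *\<^sub>R x) = t * q x"
proof (rule antisym)
  show "q (t *\<^sub>R x) \<le> t * q x"
    using assms by (simp add: sublinear_def)
  have "q ((1/t) *\<^sub>R (t *\<^sub>R x)) \<le> (1/t) * q (t *\<^sub>R x)"
    using assms unfolding sublinear_def by (metis zero_less_divide_1_iff)
  then show "t * q x \<le> q (t *\<^sub>R x)"
    using assms by (simp add: field_simps)
qed

lemma sublinear_zero:
  assumes "sublinear q"
  shows "q 0 = 0"
  using sublinear_scaleR[OF assms, of 2 0] by simp

lemma sublinear_ge:
  assumes "sublinear q"
  shows "- q (- x) \<le> q x"
  using sublinear_add[OF assms, of x "- x"] sublinear_zero[OF assms] by simp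

lemma sublinear_norm: "K \<ge> 0 \<Longrightarrow> sublinear (\<lambda>x. K * norm x)"
  unfolding sublinear_def
  by (auto simp: distrib_left[symmetric] intro!: mult_left_mono norm_triangle_ineq)

text \<open>A pair \<open>(k, s)\<close> in the convex cone \<open>A\<close> stands for the
  constraint \<open>0 \<le> f k + s\<close> on a linear \<open>f\<close>. The witness
  \<open>p\<close> is the infimum of \<open>q (x + k) + s\<close> over \<open>A\<close>: the last
  hypothesis bounds it below by \<open>- q (- x)\<close>, and closure of \<open>A\<close> under sums
  and positive multiples makes it sublinear.\<close>

lemma sublinear_infimal_convolution:
  fixes q :: "'a::real_vector \<Rightarrow> real" and A :: "('a \<times> real) set"
  assumes q: "sublinear q"
    and zero: "0 \<in> A"
    and add: "\<And>a b. a \<in> A \<Longrightarrow> b \<in> A \<Longrightarrow> a + b \<in> A"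
    and scale: "\<And>t a. t > 0 \<Longrightarrow> a \<in> A \<Longrightarrow> t *\<^sub>R a \<in> A"
    and nonneg: "\<And>k s. (k, s) \<in> A \<Longrightarrow> 0 \<le> q k + s"
  shows "\<exists>p. sublinear p \<and> (\<forall>x. p x \<le> q x) \<and> (\<forall>(k, s)\<in>A. p (- k) \<le> s)"
proof -
  define p where "p x = (INF a\<in>A. q (x + fst a) + snd a)" for x
  have lower: "- q (- x) \<le> q (x + fst a) + snd a" if "a \<in> A" for a x
  proof -
    have "q (fst a) \<le> q (- x) + q (x + fst a)"
      using sublinear_add[OF q, of "- x" "x + fst a"] by simp
    then show ?thesis
      using nonneg[of "fst a" "snd a"] that by simp
  qed
  have le: "p x \<le> q (x + fst a) + snd a" if "a \<in> A" for x a
    unfolding p_def by (rule cINF_lower) (use that lower in \<open>auto intro!: bdd_belowI2\<close>)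
  have ge: "c \<le> p x" if "\<And>a. a \<in> A \<Longrightarrow> c \<le> q (x + fst a) + snd a" for c x
    unfolding p_def by (rule cINF_greatest) (use that zero in auto)
  have "p (x + y) \<le> p x + p y" for x y
  proof -
    have "p (x + y) \<le> (q (x + fst a) + snd a) + (q (y + fst b) + snd b)"
      if "a \<in> A" "b \<in> A" for a b
    proof -
      have "q ((x + y) + fst (a + b)) \<le> q (x + fst a) + q (y + fst b)"
        using sublinear_add[OF q, of "x + fst a" "y + fst b"] by (simp add: algebra_simps)
      then show ?thesis
        using le[OF add[OF that], of "x + y"] by simp
    qed
    then have "p (x + y) - (q (y + fst b) + snd b) \<le> p x" if "b \<in> A" for b
      using that by (intro ge) (simp add: algebra_simps)
    then have "p (x + y) - p x \<le> p y"
      by (intro ge) (simp add: algebra_simps)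
    then show ?thesis by simp
  qed
  moreover have "p (t *\<^sub>R x) \<le> t * p x" if "t > 0" for t x
  proof -
    have "p (t *\<^sub>R x) / t \<le> q (x + fst a) + snd a" if "a \<in> A" for a
    proof -
      have "p (t *\<^sub>R x) \<le> q (t *\<^sub>R (x + fst a)) + t * snd a"
        using le[OF scale[OF \<open>t > 0\<close> that], of "t *\<^sub>R x"] by (simp add: scaleR_add_right)
      then show ?thesis
        using \<open>t > 0\<close> unfolding sublinear_scaleR[OF q \<open>t > 0\<close>] by (simp add: field_simps)
    qed
    then have "p (t *\<^sub>R x) / t \<le> p x" by (rule ge)
    then show ?thesis using \<open>t > 0\<close> by (simp add: field_simps)
  qed
  moreover have "p x \<le> q x" for x
    using le[OF zero, of x] by simp
  moreover have "p (- k) \<le> s" if "(k, s) \<in> A" for k s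
    using le[OF that, of "- k"] sublinear_zero[OF q] by simp
  ultimately show ?thesis
    unfolding sublinear_def by blast
qed

text \<open>The bound \<open>p\<close> keeps the infimum finite, since each \<open>q\<close>
  satisfies \<open>- p (- x) \<le> q x\<close>. For subadditivity, two members \<open>q\<close> and
  \<open>r\<close> are both replaced by the smaller of them.\<close>

lemma sublinear_chain_INF:
  fixes C :: "('a::real_vector \<Rightarrow> real) set"
  assumes ne: "C \<noteq> {}"
    and sub: "\<And>q. q \<in> C \<Longrightarrow> sublinear q"
    and chain: "\<And>q r. q \<in> C \<Longrightarrow> r \<in> C \<Longrightarrow> q \<le> r \<or> r \<le> q"
    and bdd: "\<And>q x. q \<in> C \<Longrightarrow> q x \<le> p x"
  shows "sublinear (\<lambda>x. INF q\<in>C. q x)" and "\<And>q. q \<in> C \<Longrightarrow> (\<lambda>x. INF q\<in>C. q x) \<le> q"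
proof -
  define u where "u x = (INF q\<in>C. q x)" for x
  have "- p (- x) \<le> q x" if "q \<in> C" for q x
    using sublinear_ge[OF sub[OF that], of x] bdd[OF that, of "- x"] by simp
  then have le: "u x \<le> q x" if "q \<in> C" for q x
    unfolding u_def by (intro cINF_lower bdd_belowI2[of _ "- p (- x)"]) (use that in auto)
  then show "\<And>q. q \<in> C \<Longrightarrow> (\<lambda>x. INF q\<in>C. q x) \<le> q"
    by (simp add: u_def le_fun_def)
  have ge: "c \<le> u x" if "\<And>q. q \<in> C \<Longrightarrow> c \<le> q x" for c x
    unfolding u_def by (rule cINF_greatest) (use that ne in auto)
  have "u (x + y) \<le> u x + u y" for x y
  proof -
    have "u (x + y) \<le> q x + r y" if qr: "q \<in> C" "r \<in> C" for q r
    proof -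
      obtain v where v: "v \<in> C" "v \<le> q" "v \<le> r"
        using chain[OF qr] qr by blast
      have "u (x + y) \<le> v (x + y)" using le v by blast
      also have "\<dots> \<le> v x + v y" using sub v sublinear_add by blast
      also have "\<dots> \<le> q x + r y" using v by (simp add: le_fun_def add_mono)
      finally show ?thesis .
    qed
    then have "u (x + y) - r y \<le> u x" if "r \<in> C" for r
      using that by (intro ge) (simp add: algebra_simps)
    then have "u (x + y) - u x \<le> u y"
      by (intro ge) (simp add: algebra_simps)
    then show ?thesis by simp
  qed
  moreover have "u (t *\<^sub>R x) \<le> t * u x" if "t > 0" for t x
  proof -
    have "u (t *\<^sub>R x) / t \<le> u x"
    proof (rule ge)
      fix q assume "q \<in> C"
      then show "u (t *\<^sub>R x) / t \<le> q x"
        using le[of q "t *\<^sub>R x"] sublinear_scaleR[OF sub that, of q x] that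
        by (simp add: field_simps)
    qed
    then show ?thesis using that by (simp add: field_simps)
  qed
  ultimately show "sublinear (\<lambda>x. INF q\<in>C. q x)"
    unfolding sublinear_def u_def by blast
qed

text \<open>Zorn's lemma for the reversed pointwise order on the sublinear functionals below
  \<open>p\<close>: pointwise infima bound the nonempty chains, and \<open>p\<close> bounds the
  empty one.\<close>

lemma sublinear_minimal_exists:
  fixes p :: "'a::real_vector \<Rightarrow> real"
  assumes p: "sublinear p"
  shows "\<exists>q. sublinear q \<and> q \<le> p \<and> (\<forall>r. sublinear r \<and> r \<le> q \<longrightarrow> r = q)"
proof -
  define S where "S = {q. sublinear q \<and> q \<le> p}"
  have "\<exists>m\<in>S. \<forall>a\<in>S. a \<le> m \<longrightarrow> a = m"
  proof (rule predicate_Zorn)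
    show "partial_order_on S (relation_of (\<lambda>a b. b \<le> a) S)"
      by (auto simp: partial_order_on_def preorder_on_def refl_on_def trans_def antisym_def
          relation_of_def)
    fix C assume C: "C \<in> Chains (relation_of (\<lambda>a b. b \<le> a) S)"
    then have CS: "C \<subseteq> S" and chain: "\<And>q r. q \<in> C \<Longrightarrow> r \<in> C \<Longrightarrow> q \<le> r \<or> r \<le> q"
      by (auto simp: Chains_def relation_of_def)
    show "\<exists>u\<in>S. \<forall>a\<in>C. u \<le> a"
    proof (cases "C = {}")
      case True
      then show ?thesis using p by (auto simp: S_def)
    next
      case False
      have *: "\<And>q. q \<in> C \<Longrightarrow> sublinear q" "\<And>q x. q \<in> C \<Longrightarrow> q x \<le> p x"
        using CS by (auto simp: S_def le_fun_def)
      note inf = sublinear_chain_INF[where C = C and p = p, OF False _ chain]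
      obtain q where "q \<in> C" using False by blast
      then have "(\<lambda>x. INF q\<in>C. q x) \<le> p"
        using inf(2) * CS unfolding S_def by (blast intro: order_trans)
      then show ?thesis
        using inf * unfolding S_def by blast
    qed
  qed
  then show ?thesis
    unfolding S_def by (metis (mono_tags, lifting) mem_Collect_eq order_trans)
qed

text \<open>A minimal sublinear functional \<open>q\<close> is linear: by minimality, it equals the infimal
  convolution \<open>inf {q (x + t y) - t q y | t \<ge> 0}\<close>, which makes \<open>q\<close> odd.\<close>

lemma sublinear_dominates_linear:
  fixes p :: "'a::real_vector \<Rightarrow> real"
  assumes "sublinear p"
  shows "\<exists>f. linear f \<and> (\<forall>x. f x \<le> p x)"
proof -
  obtain q where q: "sublinear q" "q \<le> p" and min: "\<And>r. sublinear r \<Longrightarrow> r \<le> q \<Longrightarrow> r = q"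
    using sublinear_minimal_exists[OF assms] by blast
  have odd: "q (- y) = - q y" for y
  proof -
    \<comment> \<open>The ray through \<open>(y, - q y)\<close>; its constraint at
      \<open>t = 1\<close> reads \<open>r (- y) \<le> - q y\<close>.\<close>
    define A where "A = {(t *\<^sub>R y, - (t * q y)) | t. t \<ge> 0}"
    have "\<exists>r. sublinear r \<and> (\<forall>x. r x \<le> q x) \<and> (\<forall>(k, s)\<in>A. r (- k) \<le> s)"
    proof (rule sublinear_infimal_convolution[OF q(1)])
      show "0 \<in> A" by (auto simp: A_def zero_prod_def)
      show "a + b \<in> A" if ab: "a \<in> A" "b \<in> A" for a b
      proof -
        obtain t u where tu: "t \<ge> 0" "u \<ge> 0" "a = (t *\<^sub>R y, - (t * q y))" "b = (u *\<^sub>R y, - (u * q y))"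
          using ab by (auto simp: A_def)
        then show ?thesis
          unfolding A_def by (auto intro!: exI[of _ "t + u"] simp: algebra_simps)
      qed
      show "t *\<^sub>R a \<in> A" if ta: "t > 0" "a \<in> A" for t a
      proof -
        obtain u where u: "u \<ge> 0" "a = (u *\<^sub>R y, - (u * q y))"
          using ta by (auto simp: A_def)
        then show ?thesis
          unfolding A_def using ta(1) by (auto intro!: exI[of _ "t * u"])
      qed
      show "0 \<le> q k + s" if ks: "(k, s) \<in> A" for k s
      proof -
        obtain t where t: "t \<ge> 0" "k = t *\<^sub>R y" "s = - (t * q y)"
          using ks by (auto simp: A_def)
        then show ?thesis
          by (cases "t = 0") (simp_all add: sublinear_zero[OF q(1)] sublinear_scaleR[OF q(1)])
      qed
    qed
    then obtain r where r: "sublinear r" "r \<le> q" "\<forall>(k, s)\<in>A. r (- k) \<le> s"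
      by (auto simp: le_fun_def)
    have "(y, - q y) \<in> A" unfolding A_def by (auto intro!: exI[of _ 1])
    then have "q (- y) \<le> - q y" using r(3) min[OF r(1,2)] by auto
    then show ?thesis using sublinear_ge[OF q(1), of y] by simp
  qed
  have "linear q"
  proof (rule linearI)
    fix x y
    \<comment> \<open>Oddness turns subadditivity at \<open>- x\<close>, \<open>- y\<close> into
      superadditivity at \<open>x\<close>, \<open>y\<close>.\<close>
    have "- q (x + y) \<le> - q x + - q y"
      using sublinear_add[OF q(1), of "- x" "- y"] odd[of "x + y"] odd[of x] odd[of y]
      by simp
    then show "q (x + y) = q x + q y"
      using sublinear_add[OF q(1), of x y] by simp
  next
    fix t :: real and x
    consider "t > 0" | "t = 0" | "t < 0" by linarith
    then show "q (t *\<^sub>R x) = t *\<^sub>R q x"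
    proof cases
      case 1 then show ?thesis by (simp add: sublinear_scaleR[OF q(1)])
    next
      case 2 then show ?thesis by (simp add: sublinear_zero[OF q(1)])
    next
      case 3
      then show ?thesis
        using sublinear_scaleR[OF q(1), of "- t" x] odd[of "t *\<^sub>R x"] by simp
    qed
  qed
  then show ?thesis using q(2) by (auto simp: le_fun_def)
qed

text \<open>The common source of extension and separation. A linear \<open>f\<close> below the
  convolution \<open>p\<close> has \<open>- f k = f (- k) \<le> p (- k) \<le> s\<close>, which is
  the constraint of \<open>(k, s)\<close>.\<close>

lemma hahn_banach_cone:
  fixes q :: "'a::real_vector \<Rightarrow> real" and A :: "('a \<times> real) set"
  assumes q: "sublinear q"
    and zero: "0 \<in> A"
    and add: "\<And>a b. a \<in> A \<Longrightarrow> b \<in> A \<Longrightarrow> a + b \<in> A"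
    and scale: "\<And>t a. t > 0 \<Longrightarrow> a \<in> A \<Longrightarrow> t *\<^sub>R a \<in> A"
    and nonneg: "\<And>k s. (k, s) \<in> A \<Longrightarrow> 0 \<le> q k + s"
  shows "\<exists>f. linear f \<and> (\<forall>x. f x \<le> q x) \<and> (\<forall>(k, s)\<in>A. 0 \<le> f k + s)"
proof -
  obtain p where p: "sublinear p" "\<And>x. p x \<le> q x" "\<And>k s. (k, s) \<in> A \<Longrightarrow> p (- k) \<le> s"
    using sublinear_infimal_convolution[OF assms] by blast
  obtain f where f: "linear f" "\<And>x. f x \<le> p x"
    using sublinear_dominates_linear[OF p(1)] by blast
  have "0 \<le> f k + s" if "(k, s) \<in> A" for k s
    using f(2)[of "- k"] p(3)[OF that] linear_neg[OF f(1), of k] by simp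
  then show ?thesis
    using f order_trans[OF f(2) p(2)] by (intro exI[of _ f]) auto
qed

section \<open>Extension and separation by bounded functionals\<close>

lemma linear_le_norm_imp_dual_on:
  assumes "linear f" "\<And>x. f x \<le> K * norm x"
  shows "f \<in> dual_on Y"
proof -
  have "\<bar>f x\<bar> \<le> K * norm x" for x
    using assms(2)[of x] assms(2)[of "- x"] linear_neg[OF assms(1), of x] by simp
  then show ?thesis
    unfolding dual_on_def using linear_add[OF assms(1)] linear_scale[OF assms(1)] by auto
qed

lemma dual_on_mono: "f \<in> dual_on Z \<Longrightarrow> Y \<subseteq> Z \<Longrightarrow> f \<in> dual_on Y"
  unfolding dual_on_def by blast

text \<open>The constraints imposed are \<open>g y \<le> f y\<close> for \<open>y \<in> Y\<close>;
  used at both \<open>y\<close> and \<open>- y\<close> they force equality.\<close>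

lemma dual_on_extension:
  fixes Y :: "'a::real_normed_vector set"
  assumes Y: "subspace Y" and g: "g \<in> dual_on Y"
  shows "\<exists>f\<in>dual_on UNIV. \<forall>y\<in>Y. f y = g y"
proof -
  have gadd: "g (x + y) = g x + g y" if "x \<in> Y" "y \<in> Y" for x y
    using g that by (simp add: dual_on_def)
  have gscale: "g (c *\<^sub>R x) = c * g x" if "x \<in> Y" for c x
    using g that by (simp add: dual_on_def)
  obtain K where K: "\<And>x. x \<in> Y \<Longrightarrow> \<bar>g x\<bar> \<le> K * norm x"
    using g unfolding dual_on_def by blast
  \<comment> \<open>The bound \<open>K\<close> may be negative when \<open>Y\<close> is the zero
    space; its absolute value gives a sublinear majorant.\<close>
  have K': "\<bar>g x\<bar> \<le> \<bar>K\<bar> * norm x" if "x \<in> Y" for x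
    using K[OF that] by (meson abs_ge_self mult_right_mono norm_ge_zero order_trans)
  define A where "A = {(y, - g y) | y. y \<in> Y}"
  have "\<exists>f. linear f \<and> (\<forall>x. f x \<le> \<bar>K\<bar> * norm x) \<and> (\<forall>(k, s)\<in>A. 0 \<le> f k + s)"
  proof (rule hahn_banach_cone)
    show "sublinear (\<lambda>x::'a. \<bar>K\<bar> * norm x)" by (simp add: sublinear_norm)
    show "0 \<in> A"
      using subspace_0[OF Y] gscale[of 0 0] by (auto simp: A_def zero_prod_def)
    show "a + b \<in> A" if "a \<in> A" "b \<in> A" for a b
      using that subspace_add[OF Y] gadd by (auto simp: A_def)
    show "t *\<^sub>R a \<in> A" if "t > 0" "a \<in> A" for t a
      using that subspace_scale[OF Y] gscale by (auto simp: A_def)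
    show "0 \<le> \<bar>K\<bar> * norm k + s" if "(k, s) \<in> A" for k s
      using that K'[of k] by (auto simp: A_def)
  qed
  then obtain f where f: "linear f" "\<And>x. f x \<le> \<bar>K\<bar> * norm x" "\<And>k s. (k, s) \<in> A \<Longrightarrow> 0 \<le> f k + s"
    by blast
  have ge: "g y \<le> f y" if "y \<in> Y" for y
    using f(3)[of y "- g y"] that by (auto simp: A_def)
  have "f y = g y" if "y \<in> Y" for y
    using ge[OF that] ge[OF subspace_neg[OF Y that]] linear_neg[OF f(1), of y]
      gscale[OF that, of "-1"] by simp
  then show ?thesis
    using linear_le_norm_imp_dual_on[OF f(1,2)] by blast
qed

text \<open>With \<open>d\<close> the distance from \<open>l\<close> to \<open>L\<close>, the cone
  over \<open>L - l\<close> imposes \<open>d \<le> f (x - l)\<close> for \<open>x \<in> L\<close>;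
  this is compatible with \<open>f x \<le> norm x\<close> because
  \<open>d \<le> norm (x - l)\<close>.\<close>

lemma dual_on_separation:
  fixes L :: "'a::real_normed_vector set"
  assumes L: "closed L" "convex L" and l: "l \<notin> L"
  shows "\<exists>f\<in>dual_on UNIV. \<exists>r. f l < r \<and> (\<forall>x\<in>L. r < f x)"
proof (cases "L = {}")
  case True
  \<comment> \<open>\<open>infdist\<close> to the empty set is \<open>0\<close>, so this case is
    settled apart, by the zero functional and \<open>r = 1\<close>.\<close>
  have "(\<lambda>_. 0) \<in> dual_on (UNIV :: 'a set)" by (auto simp: dual_on_def intro: exI[of _ 0])
  then show ?thesis using True by (auto intro!: bexI[of _ "\<lambda>_. 0"] exI[of _ 1])
next
  case False
  define d where "d = infdist l L"
  have d: "d > 0"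
    using L(1) False l by (simp add: d_def infdist_pos_not_in_closed)
  have dle: "d \<le> norm (x - l)" if "x \<in> L" for x
    using infdist_le[OF that, of l] by (simp add: d_def dist_norm norm_minus_commute)
  define A where "A = {(t *\<^sub>R (x - l), - (t * d)) | t x. t \<ge> 0 \<and> x \<in> L}"
  have "\<exists>f. linear f \<and> (\<forall>x. f x \<le> 1 * norm x) \<and> (\<forall>(k, s)\<in>A. 0 \<le> f k + s)"
  proof (rule hahn_banach_cone)
    show "sublinear (\<lambda>x::'a. 1 * norm x)" by (rule sublinear_norm) simp
    show "0 \<in> A"
      using False by (auto simp: A_def zero_prod_def)
    show "a + b \<in> A" if ab: "a \<in> A" "b \<in> A" for a b
    proof -
      obtain t x u y where tu: "t \<ge> 0" "u \<ge> 0" "x \<in> L" "y \<in> L"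
        and a: "a = (t *\<^sub>R (x - l), - (t * d))" and b: "b = (u *\<^sub>R (y - l), - (u * d))"
        using ab by (auto simp: A_def)
      show ?thesis
      proof (cases "t + u = 0")
        case True
        then have "a = 0" using tu a by (auto simp: zero_prod_def)
        then show ?thesis using ab by simp
      next
        case False
        then have pos: "t + u > 0" using tu by simp
        \<comment> \<open>Convexity of \<open>L\<close> enters here: the sum of
          \<open>t (x - l)\<close> and \<open>u (y - l)\<close> is \<open>(t + u) (z - l)\<close>
          with \<open>z\<close> a weighted mean of \<open>x\<close> and \<open>y\<close>.\<close>
        define z where "z = (t / (t + u)) *\<^sub>R x + (u / (t + u)) *\<^sub>R y"
        have "z \<in> L"
          unfolding z_def using tu pos
          by (intro convexD[OF L(2)]) (auto simp: add_divide_distrib[symmetric])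
        moreover have "(t + u) *\<^sub>R z = t *\<^sub>R x + u *\<^sub>R y"
          unfolding z_def using pos by (simp add: scaleR_add_right)
        ultimately show ?thesis
          unfolding A_def a b using tu
          by (auto intro!: exI[of _ "t + u"] exI[of _ z] simp: scaleR_diff_right algebra_simps)
      qed
    qed
    show "t *\<^sub>R a \<in> A" if ta: "t > 0" "a \<in> A" for t a
    proof -
      obtain u x where u: "u \<ge> 0" "x \<in> L" "a = (u *\<^sub>R (x - l), - (u * d))"
        using ta by (auto simp: A_def)
      then show ?thesis
        unfolding A_def using ta(1) by (auto intro!: exI[of _ "t * u"])
    qed
    show "0 \<le> 1 * norm k + s" if "(k, s) \<in> A" for k s
      using that dle by (auto simp: A_def mult_left_mono)
  qed
  then obtain f where f: "linear f" "\<And>x. f x \<le> 1 * norm x" "\<And>k s. (k, s) \<in> A \<Longrightarrow> 0 \<le> f k + s"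
    by blast
  have "d \<le> f x - f l" if "x \<in> L" for x
  proof -
    have "(x - l, - d) \<in> A"
      unfolding A_def using that by (auto intro!: exI[of _ 1] exI[of _ x])
    then show ?thesis using f(3) linear_diff[OF f(1)] by fastforce
  qed
  then have "f l < f l + d / 2 \<and> (\<forall>x\<in>L. f l + d / 2 < f x)"
    using d by fastforce
  then show ?thesis
    using linear_le_norm_imp_dual_on[OF f(1,2)] by blast
qed

section \<open>Weak topologies of subspaces\<close>

lemma openin_weak_topology_vimage:
  "f \<in> dual_on Y \<Longrightarrow> open U \<Longrightarrow> openin (weak_topology Y) {x\<in>Y. f x \<in> U}"
  unfolding weak_topology_def by (rule topology_generated_by_Basis) blast

text \<open>By Hahn-Banach every functional on \<open>Y\<close> extends to the whole space, so the
  generating sets for \<open>Y\<close> are traces of generating sets for \<open>Z\<close>;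
  conversely, functionals on \<open>Z\<close> restrict to \<open>Y\<close>.\<close>

lemma weak_topology_subtopology:
  fixes Y :: "'a::real_normed_vector set"
  assumes "subspace Y" "Y \<subseteq> Z"
  shows "weak_topology Y = subtopology (weak_topology Z) Y"
proof (rule topology_eq[THEN iffD2], intro allI iffI)
  fix S assume "openin (weak_topology Y) S"
  then have "generate_topology_on {{x\<in>Y. f x \<in> U} | f U. f \<in> dual_on Y \<and> open U} S"
    unfolding weak_topology_def by (rule openin_topology_generated_by)
  then show "openin (subtopology (weak_topology Z) Y) S"
  proof (rule generate_topology_on_coarsest[OF istopology_openin, rotated])
    fix s assume "s \<in> {{x\<in>Y. f x \<in> U} | f U. f \<in> dual_on Y \<and> open U}"
    then obtain g U where g: "g \<in> dual_on Y" and U: "open U" and s: "s = {x\<in>Y. g x \<in> U}"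
      by blast
    obtain f where f: "f \<in> dual_on UNIV" "\<And>y. y \<in> Y \<Longrightarrow> f y = g y"
      using dual_on_extension[OF assms(1) g] by blast
    then have "openin (weak_topology Z) {x\<in>Z. f x \<in> U}"
      using U dual_on_mono openin_weak_topology_vimage by blast
    moreover have "s = {x\<in>Z. f x \<in> U} \<inter> Y" using f(2) s assms(2) by auto
    ultimately show "openin (subtopology (weak_topology Z) Y) s"
      by (auto simp: openin_subtopology)
  qed
next
  fix S assume "openin (subtopology (weak_topology Z) Y) S"
  then obtain T where T: "openin (weak_topology Z) T" "S = T \<inter> Y"
    by (auto simp: openin_subtopology)
  then have "generate_topology_on {{x\<in>Z. f x \<in> U} | f U. f \<in> dual_on Z \<and> open U} T"
    unfolding weak_topology_def by (simp add: openin_topology_generated_by)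
  \<comment> \<open>Induction over the generation of \<open>T\<close>: taking traces on
    \<open>Y\<close> commutes with intersections and unions.\<close>
  then have "openin (weak_topology Y) (T \<inter> Y)"
  proof induction
    case (Int a b)
    then have "openin (weak_topology Y) ((a \<inter> Y) \<inter> (b \<inter> Y))" by blast
    then show ?case by (simp add: Int_ac)
  next
    case (UN K)
    then have "openin (weak_topology Y) (\<Union>k\<in>K. k \<inter> Y)" by (intro openin_Union) blast
    moreover have "(\<Union>k\<in>K. k \<inter> Y) = \<Union>K \<inter> Y" by blast
    ultimately show ?case by simp
  next
    case (Basis s)
    then obtain f U where f: "f \<in> dual_on Z" and U: "open U" and s: "s = {x\<in>Z. f x \<in> U}"
      by blast
    have "s \<inter> Y = {x\<in>Y. f x \<in> U}" using s assms(2) by auto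
    then show ?case
      using openin_weak_topology_vimage[OF dual_on_mono[OF f assms(2)] U] by simp
  qed simp
  then show "openin (weak_topology Y) S" using T by simp
qed

text \<open>Mazur's theorem: a separating functional puts each point off \<open>L\<close> in a
  weakly open half-space that misses \<open>L\<close>.\<close>

lemma closedin_weak_topology:
  fixes L :: "'a::real_normed_vector set"
  assumes "closed L" "convex L" "L \<subseteq> Y"
  shows "closedin (weak_topology Y) L"
  unfolding closedin_def topspace_weak_topology
proof (intro conjI assms(3), subst openin_subopen, intro ballI)
  fix l assume "l \<in> Y - L"
  then obtain f r where f: "f \<in> dual_on UNIV" "f l < r" "\<forall>x\<in>L. r < f x"
    using dual_on_separation[OF assms(1,2)] by blast
  have "openin (weak_topology Y) {x\<in>Y. f x \<in> {..<r}}"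
    by (intro openin_weak_topology_vimage dual_on_mono[OF f(1)]) auto
  then show "\<exists>T. openin (weak_topology Y) T \<and> l \<in> T \<and> T \<subseteq> Y - L"
    using f \<open>l \<in> Y - L\<close> by (intro exI[of _ "{x\<in>Y. f x \<in> {..<r}}"]) auto
qed

text \<open>\<open>Y\<close> is weakly closed in \<open>E\<close> by Mazur's theorem, so the weak
  closure of \<open>S\<close> in \<open>Y\<close> is a closed subset of the compact weak closure of
  \<open>A\<close> in \<open>E\<close>.\<close>

lemma relatively_weakly_compact_subspace:
  fixes Y :: "'a::real_normed_vector set"
  assumes Y: "closed_subspace Y" "Y \<subseteq> E"
    and A: "relatively_weakly_compact E A" and S: "S \<subseteq> A \<inter> Y"
  shows "relatively_weakly_compact Y S"
proof -
  let ?T = "weak_topology E"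
  have sub: "weak_topology Y = subtopology ?T Y"
    using Y weak_topology_subtopology by (auto simp: closed_subspace_def)
  have clos: "weak_topology Y closure_of S = Y \<inter> ?T closure_of S"
    using S by (simp add: sub closure_of_subtopology_open)
  have "closedin ?T (Y \<inter> ?T closure_of S)"
    using Y closedin_weak_topology[of Y E] by (auto simp: closed_subspace_def subspace_imp_convex)
  moreover have "Y \<inter> ?T closure_of S \<subseteq> ?T closure_of A"
    using S closure_of_mono[of S A ?T] by blast
  ultimately have "compactin ?T (Y \<inter> ?T closure_of S)"
    using A closed_compactin unfolding relatively_weakly_compact_def by blast
  then show ?thesis
    using S unfolding relatively_weakly_compact_def clos
    by (auto simp: sub compactin_subtopology)
qed

text \<open>Instead of extracting a convergent subsequence (Eberlein-Smulian), a subnet is indexed by the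
  weak neighbourhoods of a cluster point.\<close>

lemma mosco_ii_sequence_cluster:
  fixes Y :: "'a::real_normed_vector set" and C :: "nat \<Rightarrow> 'a set"
  assumes M: "mosco_ii TYPE(nat \<times> 'a set) Y UNIV (\<le>) C L"
    and yC: "\<And>n. y n \<in> C n"
    and rwc: "relatively_weakly_compact Y (range y)"
  shows "\<exists>l\<in>L. l \<in> weak_topology Y closure_of range y"
proof -
  let ?T = "weak_topology Y"
  define K where "K = ?T closure_of range y"
  have yY: "y n \<in> Y" for n using rwc by (auto simp: relatively_weakly_compact_def)
  have tail: "?T closure_of (y ` {n..}) \<subseteq> K" for n
    unfolding K_def by (rule closure_of_mono) blast
  \<comment> \<open>Nested nonempty closed sets in the compact space \<open>K\<close>; a common
    point is a weak cluster point of the sequence.\<close>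
  have "(\<Inter>n. ?T closure_of (y ` {n..})) \<noteq> {}"
  proof (rule compact_space_imp_nest)
    show "compact_space (subtopology ?T K)"
      using rwc by (simp add: relatively_weakly_compact_def K_def compact_space_subtopology)
    show "closedin (subtopology ?T K) (?T closure_of (y ` {n..}))" for n
      by (rule closedin_subset_topspace) (simp_all add: tail)
    show "?T closure_of (y ` {n..}) \<noteq> {}" for n
      using closure_of_subset[of "y ` {n..}" ?T] yY by (auto simp: topspace_weak_topology)
    show "decseq (\<lambda>n. ?T closure_of (y ` {n..}))"
      by (intro antimonoI closure_of_mono) auto
  qed
  then obtain l where l: "\<And>n. l \<in> ?T closure_of (y ` {n..})" by blast
  have lY: "l \<in> Y" using l[of 0] by (simp add: closure_of_def topspace_weak_topology)
  have freq: "\<exists>m\<ge>n. y m \<in> U" if "openin ?T U" "l \<in> U" for U n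
    using l[of n] that unfolding closure_of_def by auto
  \<comment> \<open>A position is paired with a weak neighbourhood of \<open>l\<close> that contains
    the term there. Going up shrinks the neighbourhood, which forces convergence to
    \<open>l\<close>. The type of these pairs is the index type in the statement.\<close>
  define B where "B = {(n, U). openin ?T U \<and> l \<in> U \<and> y n \<in> U}"
  define leB where "leB u v \<longleftrightarrow> fst u \<le> fst v \<and> snd v \<subseteq> snd u" for u v :: "nat \<times> 'a set"
  \<comment> \<open>Pairing each \<open>n\<close> with the whole space makes \<open>fst\<close>
    cofinal and keeps every term of the sequence in the image.\<close>
  have YB: "(n, Y) \<in> B" for n
    using lY yY openin_topspace[of ?T] by (simp add: B_def topspace_weak_topology)
  have dir: "directed_set B leB"
    unfolding directed_set_def
  proof (intro conjI ballI impI)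
    show "B \<noteq> {}" using YB by blast
    fix u v assume "u \<in> B" "v \<in> B"
    then obtain n U m V where uv: "u = (n, U)" "v = (m, V)"
      and UV': "openin ?T U" "openin ?T V" "l \<in> U \<inter> V"
      by (auto simp: B_def)
    have UV: "openin ?T (U \<inter> V)" "l \<in> U \<inter> V" using UV' by auto
    obtain k where k: "k \<ge> max n m" "y k \<in> U \<inter> V" using freq[OF UV] by blast
    then have "(k, U \<inter> V) \<in> B" using UV by (auto simp: B_def)
    then show "\<exists>w\<in>B. leB u w \<and> leB v w"
      using k uv by (intro bexI[of _ "(k, U \<inter> V)"]) (auto simp: leB_def)
  qed (auto simp: leB_def)
  have "subnet_map B leB fst UNIV (\<le>)"
    unfolding subnet_map_def using dir YB by (force simp: leB_def)
  moreover have "\<forall>b\<in>B. y (fst b) \<in> C (fst b)" using yC by blast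
  moreover have "relatively_weakly_compact Y ((\<lambda>b. y (fst b)) ` B)"
  proof -
    have "(\<lambda>b. y (fst b)) ` B = range y" using YB by force
    then show ?thesis using rwc by simp
  qed
  moreover have "limitin ?T (\<lambda>b. y (fst b)) l (net_filter B leB)"
    unfolding limitin_def eventually_net_filter[OF dir]
  proof (intro conjI allI impI)
    show "l \<in> topspace ?T" using lY by (simp add: topspace_weak_topology)
    fix U assume U: "openin ?T U \<and> l \<in> U"
    then obtain k where "(k, U) \<in> B" using freq by (auto simp: B_def)
    then show "\<exists>a\<in>B. \<forall>b\<in>B. leB a b \<longrightarrow> y (fst b) \<in> U"
      by (intro bexI[of _ "(k, U)"]) (auto simp: B_def leB_def)
  qed
  ultimately have "l \<in> L"
    using M[unfolded mosco_ii_def, rule_format, of B leB fst "\<lambda>b. y (fst b)" l] by blast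
  moreover have "l \<in> K" using l tail by blast
  ultimately show ?thesis unfolding K_def by blast
qed

section \<open>Separable reduction\<close>

text \<open>The additive form of the 1-Lipschitz property also covers \<open>A = {}\<close>, where
  both sides are infinite.\<close>

lemma edist_lipschitz: "edist x A \<le> ereal (dist x y) + edist y A"
proof (cases "A = {}")
  case False
  have "edist x A \<le> ereal (dist x y) + ereal (dist y a)" if "a \<in> A" for a
  proof -
    have "edist x A \<le> ereal (dist x a)" unfolding edist_def using that by (rule INF_lower)
    also have "\<dots> \<le> ereal (dist x y + dist y a)" by (simp add: dist_triangle)
    finally show ?thesis by simp
  qed
  then have "edist x A \<le> (INF a\<in>A. ereal (dist x y) + ereal (dist y a))"
    by (rule INF_greatest)
  also have "\<dots> = ereal (dist x y) + edist y A"
    unfolding edist_def using False by (intro INF_ereal_add_right) auto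
  finally show ?thesis .
qed (simp add: edist_def top_ereal_def)

lemma edist_antimono: "A \<subseteq> B \<Longrightarrow> edist x B \<le> edist x A"
  unfolding edist_def by (rule INF_superset_mono) auto

lemma edist_nonneg: "0 \<le> edist x A"
  unfolding edist_def by (rule INF_greatest) simp

lemma edist_eq_0: "x \<in> A \<Longrightarrow> edist x A = 0"
  using INF_lower[of x A "\<lambda>a. ereal (dist x a)"] edist_nonneg[of x A]
  by (simp add: edist_def zero_ereal_def[symmetric] antisym)

lemma esetdist_edist: "esetdist A B = (INF a\<in>A. edist a B)"
  unfolding esetdist_def edist_def ..

lemma esetdist_antimono: "A \<subseteq> A' \<Longrightarrow> B \<subseteq> B' \<Longrightarrow> esetdist A' B' \<le> esetdist A B"
  unfolding esetdist_edist
  by (rule INF_mono) (blast intro: edist_antimono)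

lemma esetdist_le: "a \<in> A \<Longrightarrow> b \<in> B \<Longrightarrow> esetdist A B \<le> ereal (dist a b)"
  unfolding esetdist_def by (blast intro: INF_lower2)

lemma edist_approx:
  assumes "A \<noteq> {}" "e > 0"
  shows "\<exists>a\<in>A. ereal (dist x a) \<le> edist x A + ereal e"
proof -
  obtain a0 where "a0 \<in> A" using assms(1) by blast
  then have "edist x A \<le> ereal (dist x a0)" unfolding edist_def by (rule INF_lower)
  then have "edist x A < edist x A + ereal e"
    using assms(2) edist_nonneg[of x A] by (cases "edist x A") auto
  then obtain a where "a \<in> A" "ereal (dist x a) < edist x A + ereal e"
    unfolding edist_def INF_less_iff by blast
  then show ?thesis by (auto intro: less_imp_le)
qed

text \<open>The hypothesis \<open>near\<close> supplies almost best approximants inside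
  \<open>Q\<close> for points of \<open>Q\<close>. Three errors of \<open>e / 3\<close> carry this
  to \<open>x\<close>: two for passing between \<open>x\<close> and a nearby \<open>q\<close>, one
  for the approximant.\<close>

lemma edist_inter_closure:
  fixes Q :: "'a::metric_space set"
  assumes near: "\<And>q e. q \<in> Q \<Longrightarrow> M \<noteq> {} \<Longrightarrow> e > 0 \<Longrightarrow>
      \<exists>m\<in>M \<inter> Q. ereal (dist q m) \<le> edist q M + ereal e"
    and x: "x \<in> closure Q"
  shows "edist x (M \<inter> closure Q) = edist x M"
proof (rule antisym)
  show "edist x M \<le> edist x (M \<inter> closure Q)" by (rule edist_antimono) blast
  show "edist x (M \<inter> closure Q) \<le> edist x M"
  proof (cases "M = {}")
    case False
    show ?thesis
    proof (rule ereal_le_epsilon2)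
      fix e :: real assume e: "e > 0"
      obtain q where q: "q \<in> Q" "dist q x < e / 3"
        using x e by (auto simp: closure_approachable dest: spec[of _ "e / 3"])
      obtain m where m: "m \<in> M \<inter> Q" "ereal (dist q m) \<le> edist q M + ereal (e / 3)"
        using near[OF q(1) False, of "e / 3"] e by auto
      have "edist q M \<le> ereal (dist q x) + edist x M" by (rule edist_lipschitz)
      also have "\<dots> \<le> ereal (e / 3) + edist x M" using q by (intro add_right_mono) simp
      finally have "ereal (dist q m) \<le> edist x M + ereal (2 * e / 3)"
        using m(2) by (cases "edist x M"; cases "edist q M") auto
      moreover have "edist x (M \<inter> closure Q) \<le> ereal (dist x m)"
        unfolding edist_def using m(1) closure_subset by (intro INF_lower) blast
      moreover have "dist x m \<le> e / 3 + dist q m"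
        using dist_triangle[of x m q] q(2) by (simp add: dist_commute)
      ultimately show "edist x (M \<inter> closure Q) \<le> edist x M + ereal e"
        by (cases "edist x M"; cases "edist x (M \<inter> closure Q)") auto
    qed
  qed (simp add: edist_def)
qed

text \<open>All the functions \<open>x \<mapsto> edist x (C n)\<close> are 1-Lipschitz, so
  convergence passes from \<open>Q\<close> to its closure. Order bounds in place of differences
  admit infinite distances.\<close>

lemma tendsto_edist_closure:
  fixes Q :: "'a::metric_space set"
  assumes lim: "\<And>q. q \<in> Q \<Longrightarrow> ((\<lambda>n. edist q (C n)) \<longlongrightarrow> edist q L) F"
    and x: "x \<in> closure Q"
  shows "((\<lambda>n. edist x (C n)) \<longlongrightarrow> edist x L) F"
proof -
  have key: "eventually (\<lambda>n. b < edist x (C n)) F" if b: "b < edist x L" for b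
  proof -
    \<comment> \<open>Passing from \<open>x\<close> to \<open>q\<close> and back loses less than
      half of the gap \<open>s - r\<close> each way, so the midpoint of \<open>r\<close> and
      \<open>s\<close> serves as the bound at \<open>q\<close>.\<close>
    obtain r s where rs: "b < ereal r" "r < s" "ereal s < edist x L"
      using ereal_dense2[OF b] ereal_dense2 by (metis ereal_less_ereal_Ex less_ereal.simps(1))
    obtain q where q: "q \<in> Q" "dist q x < (s - r) / 2"
      using x rs(2) by (auto simp: closure_approachable dest: spec[of _ "(s - r) / 2"])
    have "edist x L \<le> ereal (dist x q) + edist q L" by (rule edist_lipschitz)
    then have "ereal ((s + r) / 2) < edist q L"
      using rs(3) q(2) by (cases "edist q L"; cases "edist x L") (auto simp: dist_commute field_simps)
    then have "eventually (\<lambda>n. ereal ((s + r) / 2) < edist q (C n)) F"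
      using order_tendstoD(1)[OF lim[OF q(1)]] by blast
    then show ?thesis
    proof eventually_elim
      case (elim n)
      have "edist q (C n) \<le> ereal (dist q x) + edist x (C n)" by (rule edist_lipschitz)
      then have "ereal r < edist x (C n)"
        using elim q(2) by (cases "edist q (C n)"; cases "edist x (C n)") (auto simp: field_simps)
      then show ?case using rs(1) by order
    qed
  qed
  have key2: "eventually (\<lambda>n. edist x (C n) < b) F" if b: "edist x L < b" for b
  proof -
    obtain r s where rs: "edist x L < ereal r" "r < s" "ereal s < b"
      using ereal_dense2[OF b] ereal_dense2 by (metis ereal_less_ereal_Ex less_ereal.simps(1))
    obtain q where q: "q \<in> Q" "dist q x < (s - r) / 2"
      using x rs(2) by (auto simp: closure_approachable dest: spec[of _ "(s - r) / 2"])
    have "edist q L \<le> ereal (dist q x) + edist x L" by (rule edist_lipschitz)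
    then have "edist q L < ereal ((s + r) / 2)"
      using rs(1) q(2) by (cases "edist q L"; cases "edist x L") (auto simp: dist_commute field_simps)
    then have "eventually (\<lambda>n. edist q (C n) < ereal ((s + r) / 2)) F"
      using order_tendstoD(2)[OF lim[OF q(1)]] by blast
    then show ?thesis
    proof eventually_elim
      case (elim n)
      have "edist x (C n) \<le> ereal (dist x q) + edist q (C n)" by (rule edist_lipschitz)
      then have "edist x (C n) < ereal s"
        using elim q(2) by (cases "edist q (C n)"; cases "edist x (C n)")
          (auto simp: field_simps dist_commute)
      then show ?case using rs(3) by order
    qed
  qed
  show ?thesis by (rule order_tendstoI) (use key key2 in auto)
qed

section \<open>Construction of the separable subspace\<close>

text \<open>Rational scalars allow a countable \<open>Q\<close>. Density of the rationals gives real
  scalars on \<open>Q\<close>, and limits then give all points of the closure.\<close>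

lemma subspace_closure_rational:
  fixes Q :: "'a::real_normed_vector set"
  assumes "Q \<noteq> {}"
    and comb: "\<And>r x y. r \<in> \<rat> \<Longrightarrow> x \<in> Q \<Longrightarrow> y \<in> Q \<Longrightarrow> r *\<^sub>R x + y \<in> Q"
  shows "subspace (closure Q)"
proof -
  have real: "c *\<^sub>R x + y \<in> closure Q" if c: "x \<in> Q" "y \<in> Q" for c x y
  proof -
    have "c \<in> closure \<rat>" using Rats_closure_real by simp
    then obtain r where r: "\<And>n. r n \<in> \<rat>" "r \<longlonglongrightarrow> c"
      unfolding closure_sequential by blast
    have "(\<lambda>n. r n *\<^sub>R x + y) \<longlonglongrightarrow> c *\<^sub>R x + y" by (intro tendsto_intros r(2))
    then show ?thesis
      unfolding closure_sequential using comb[OF r(1) c] by (intro exI[of _ "\<lambda>n. r n *\<^sub>R x + y"]) simp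
  qed
  have all: "c *\<^sub>R x + y \<in> closure Q" if "x \<in> closure Q" "y \<in> closure Q" for c x y
  proof -
    obtain u v where u: "\<And>n. u n \<in> Q" "u \<longlonglongrightarrow> x" and v: "\<And>n. v n \<in> Q" "v \<longlonglongrightarrow> y"
      using \<open>x \<in> closure Q\<close> \<open>y \<in> closure Q\<close> unfolding closure_sequential by blast
    have "(\<lambda>n. c *\<^sub>R u n + v n) \<longlonglongrightarrow> c *\<^sub>R x + y" by (intro tendsto_intros u v)
    moreover have "c *\<^sub>R u n + v n \<in> closure Q" for n by (rule real) (use u v in auto)
    ultimately show ?thesis
      by (rule closed_sequentially[OF closed_closure, rotated])
  qed
  obtain x where "x \<in> closure Q" using assms(1) closure_subset by blast
  then have "0 \<in> closure Q" using all[of x x "-1"] by simp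
  then show ?thesis
    unfolding subspace_def using all[of _ _ 1] all[of _ 0] by auto
qed

text \<open>The sequence and the subspace are built together: stage \<open>n\<close> holds a finite set of points, the
  finite family of sets chosen so far, and the current index.  The next index is chosen so that the
  distances from the present points are close to their limits; afterwards finitely many
  combinations and near-best approximants are added.\<close>

lemma separable_reduction:
  fixes E :: "'a::real_normed_vector set" and C :: "'i \<Rightarrow> 'a set" and h :: "'i \<Rightarrow> 'a set"
  assumes E: "closed_subspace E" and D: "directed_set D le"
    and CE: "\<And>a. a \<in> D \<Longrightarrow> C a \<subseteq> E" and LE: "L \<subseteq> E"
    and W: "wijsman_conv E D le C L"
    and G: "G \<subseteq> D" "\<And>a. a \<in> D \<Longrightarrow> \<exists>b\<in>G. le a b"
    and h: "\<And>a. a \<in> G \<Longrightarrow> finite (h a) \<and> h a \<subseteq> E"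
  shows "\<exists>Y (\<alpha> :: nat \<Rightarrow> 'i). closed_subspace Y \<and> Y \<subseteq> E \<and> separable_space (top_of_set Y) \<and>
           (\<forall>n. \<alpha> n \<in> G \<and> le (\<alpha> n) (\<alpha> (Suc n)) \<and> h (\<alpha> n) \<subseteq> Y) \<and>
           wijsman_conv Y UNIV (\<le>) (\<lambda>n. C (\<alpha> n) \<inter> Y) (L \<inter> Y)"
proof -
  have D_ne: "D \<noteq> {}" and D_up: "\<And>a b. a \<in> D \<Longrightarrow> b \<in> D \<Longrightarrow> \<exists>c\<in>D. le a c \<and> le b c"
    and D_trans: "\<And>a b c. le a b \<Longrightarrow> le b c \<Longrightarrow> a \<in> D \<Longrightarrow> b \<in> D \<Longrightarrow> c \<in> D \<Longrightarrow> le a c"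
    using D unfolding directed_set_def by blast+
  have subE: "subspace E" and clE: "closed E" using E by (auto simp: closed_subspace_def)
  \<comment> \<open>A countable neighbourhood base at each limit \<open>edist x L\<close>: asking
    for a distance in \<open>N x n\<close> at stage \<open>n\<close> expresses convergence, also to
    an infinite limit.\<close>
  have "\<forall>x. \<exists>N :: nat \<Rightarrow> ereal set. (\<forall>n. open (N n) \<and> edist x L \<in> N n) \<and>
      (\<forall>S. open S \<longrightarrow> edist x L \<in> S \<longrightarrow> eventually (\<lambda>n. N n \<subseteq> S) sequentially)"
    using countable_basis_at_decseq by metis
  then obtain N :: "'a \<Rightarrow> nat \<Rightarrow> ereal set" where
    N: "\<And>x n. open (N x n)" "\<And>x n. edist x L \<in> N x n"
      "\<And>x S. open S \<Longrightarrow> edist x L \<in> S \<Longrightarrow> eventually (\<lambda>n. N x n \<subseteq> S) sequentially"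
    by metis
  \<comment> \<open>A point of \<open>M\<close> whose distance from \<open>x\<close> is best up to
    \<open>1 / (n + 1)\<close>; it is arbitrary for empty \<open>M\<close>, which
    \<open>near\<close> therefore leaves out.\<close>
  define p where
    "p M x n = (SOME m. m \<in> M \<and> ereal (dist x m) \<le> edist x M + ereal (1 / real (Suc n)))"
    for M and x :: 'a and n :: nat
  have p: "p M x n \<in> M \<and> ereal (dist x (p M x n)) \<le> edist x M + ereal (1 / real (Suc n))"
    if "M \<noteq> {}" for M x n
    unfolding p_def by (rule someI_ex) (use edist_approx[OF that, of "1 / real (Suc n)" x] in auto)
  define R where "R n = from_nat_into (\<rat> :: real set) ` {..n}" for n :: nat
  define comb where "comb n F = (\<lambda>(r, x, y). r *\<^sub>R x + y) ` (R n \<times> F \<times> F)" for n and F :: "'a set"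
  define near where "near n \<M> F = (\<lambda>(M, x, k). p M x k) ` ((\<M> - {{}}) \<times> F \<times> {..n})"
    for n and \<M> :: "'a set set" and F
  \<comment> \<open>The invariant of a stage. \<open>0 \<in> F\<close> makes the union of the stages
    nonempty, and \<open>h a \<subseteq> F\<close> places the witnesses in the final
    subspace.\<close>
  define P where "P n = (\<lambda>(a, \<M>, F). a \<in> G \<and> finite \<M> \<and> (\<forall>M\<in>\<M>. M \<subseteq> E) \<and> C a \<in> \<M> \<and> L \<in> \<M> \<and>
      finite F \<and> F \<subseteq> E \<and> 0 \<in> F \<and> h a \<subseteq> F)" for n :: nat
  \<comment> \<open>\<open>near\<close> works with the old family, so \<open>C a'\<close> receives
    its approximants from the following stage on.\<close>
  define T where "T n = (\<lambda>(a, \<M>, F) (a', \<M>', F'). le a a' \<and> \<M>' = insert (C a') \<M> \<and>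
      F' = F \<union> comb n F \<union> near n \<M> F \<union> h a' \<and> (\<forall>x\<in>F. edist x (C a') \<in> N x n))" for n
  have "\<exists>f. \<forall>n. P n (f n) \<and> T n (f n) (f (Suc n))"
  proof (rule dependent_nat_choice)
    obtain a where "a \<in> G" using G(2) D_ne by blast
    then have "P 0 (a, {C a, L}, insert 0 (h a))"
      using h[of a] CE[of a] G(1) LE subspace_0[OF subE] by (auto simp: P_def)
    then show "\<exists>x. P 0 x" by blast
  next
    fix s n assume "P n s"
    moreover obtain a \<M> F where s: "s = (a, \<M>, F)" by (cases s)
    ultimately have PE: "a \<in> G" "finite \<M>" "\<And>M. M \<in> \<M> \<Longrightarrow> M \<subseteq> E" "C a \<in> \<M>" "L \<in> \<M>"
      "finite F" "F \<subseteq> E" "0 \<in> F" "h a \<subseteq> F"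
      unfolding P_def by auto
    have "eventually (\<lambda>b. edist x (C b) \<in> N x n) (net_filter D le)" if x: "x \<in> F" for x
    proof (rule topological_tendstoD[OF _ N(1,2)])
      show "((\<lambda>b. edist x (C b)) \<longlongrightarrow> edist x L) (net_filter D le)"
        using W x PE(7) unfolding wijsman_conv_def by blast
    qed
    then have "eventually (\<lambda>b. \<forall>x\<in>F. edist x (C b) \<in> N x n) (net_filter D le)"
      using PE(6) by (simp add: eventually_ball_finite)
    then obtain c where c: "c \<in> D" "\<And>b. b \<in> D \<Longrightarrow> le c b \<Longrightarrow> \<forall>x\<in>F. edist x (C b) \<in> N x n"
      unfolding eventually_net_filter[OF D] by blast
    \<comment> \<open>A bound of the current index and the threshold \<open>c\<close> is moved up
      into the cofinal set \<open>G\<close>; the estimates persist above \<open>c\<close>.\<close>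
    obtain c' where c': "c' \<in> D" "le a c'" "le c c'"
      using D_up[of a c] c(1) PE(1) G(1) by blast
    obtain a' where a': "a' \<in> G" "le c' a'" using G(2) c'(1) by blast
    have "le a a'" "le c a'"
      using D_trans[OF c'(2) a'(2)] D_trans[OF c'(3) a'(2)] a'(1) c'(1) c(1) PE(1) G(1) by blast+
    define F' where "F' = F \<union> comb n F \<union> near n \<M> F \<union> h a'"
    have "finite F'"
      unfolding F'_def comb_def near_def R_def using PE(2,6) h[OF a'(1)] by auto
    moreover have "comb n F \<subseteq> E"
      unfolding comb_def using PE(7) by (auto intro!: subspace_add[OF subE] subspace_scale[OF subE])
    moreover have "near n \<M> F \<subseteq> E"
    proof
      fix w assume "w \<in> near n \<M> F"
      then obtain M x k where M: "M \<in> \<M>" "M \<noteq> {}" "w = p M x k" by (auto simp: near_def)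
      then show "w \<in> E" using p[OF M(2), of x k] PE(3)[OF M(1)] by blast
    qed
    moreover have a'D: "a' \<in> D" using a'(1) G(1) by blast
    ultimately have "F' \<subseteq> E" "C a' \<subseteq> E"
      using PE(7) h[OF a'(1)] CE[OF a'D] unfolding F'_def by auto
    then have "P (Suc n) (a', insert (C a') \<M>, F')"
      unfolding P_def using PE(2,3,5,8) a'(1) \<open>finite F'\<close> by (auto simp: F'_def)
    moreover have "T n s (a', insert (C a') \<M>, F')"
      unfolding T_def s F'_def using \<open>le a a'\<close> c(2)[OF a'D \<open>le c a'\<close>] by simp
    ultimately show "\<exists>y. P (Suc n) y \<and> T n s y" by blast
  qed
  then obtain f where f: "\<And>n. P n (f n)" "\<And>n. T n (f n) (f (Suc n))" by blast
  define \<alpha> where "\<alpha> n = fst (f n)" for n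
  define \<M> where "\<M> n = fst (snd (f n))" for n
  define F where "F n = snd (snd (f n))" for n
  have feq: "f n = (\<alpha> n, \<M> n, F n)" for n by (simp add: \<alpha>_def \<M>_def F_def)
  have P: "\<alpha> n \<in> G" "C (\<alpha> n) \<in> \<M> n" "L \<in> \<M> n" "finite (F n)" "F n \<subseteq> E" "0 \<in> F n" "h (\<alpha> n) \<subseteq> F n" for n
    using f(1)[of n] unfolding P_def feq by auto
  have T: "le (\<alpha> n) (\<alpha> (Suc n))" "\<M> n \<subseteq> \<M> (Suc n)" "F n \<subseteq> F (Suc n)" "comb n (F n) \<subseteq> F (Suc n)"
    "near n (\<M> n) (F n) \<subseteq> F (Suc n)" "\<And>x. x \<in> F n \<Longrightarrow> edist x (C (\<alpha> (Suc n))) \<in> N x n" for n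
    using f(2)[of n] unfolding T_def feq by auto
  have Fmono: "F m \<subseteq> F n" if "m \<le> n" for m n using T(3) that by (rule lift_Suc_mono_le)
  have Mmono: "\<M> m \<subseteq> \<M> n" if "m \<le> n" for m n using T(2) that by (rule lift_Suc_mono_le)
  define Q where "Q = (\<Union>n. F n)"
  define Y where "Y = closure Q"
  have QE: "Q \<subseteq> E" using P(5) by (auto simp: Q_def)
  have QY: "Q \<subseteq> Y" unfolding Y_def by (rule closure_subset)
  have Qcomb: "r *\<^sub>R x + y \<in> Q" if rxy: "r \<in> \<rat>" "x \<in> Q" "y \<in> Q" for r x y
  proof -
    obtain i j where "x \<in> F i" "y \<in> F j" using rxy(2,3) by (auto simp: Q_def)
    moreover obtain k where k: "r = from_nat_into (\<rat> :: real set) k"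
      using from_nat_into_surj[OF countable_rat rxy(1)] by metis
    ultimately have "r \<in> R (i + j + k)" "x \<in> F (i + j + k)" "y \<in> F (i + j + k)"
      using Fmono[of i "i + j + k"] Fmono[of j "i + j + k"] by (auto simp: R_def)
    then have "r *\<^sub>R x + y \<in> comb (i + j + k) (F (i + j + k))" unfolding comb_def by force
    then show ?thesis using T(4) unfolding Q_def by blast
  qed
  have Qnear: "\<exists>m\<in>M \<inter> Q. ereal (dist q m) \<le> edist q M + ereal e"
    if M: "M \<in> \<M> j" "M \<noteq> {}" and q: "q \<in> Q" and e: "e > 0" for M j q e
  proof -
    obtain i where i: "q \<in> F i" using q by (auto simp: Q_def)
    obtain k where k: "1 / real (Suc k) < e" using e nat_approx_posE by blast
    \<comment> \<open>A stage late enough for the set, the point and the accuracy at once.\<close>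
    define n where "n = i + j + k"
    have "M \<in> \<M> n" "q \<in> F n" "k \<le> n"
      using M(1) i Mmono[of j n] Fmono[of i n] by (auto simp: n_def)
    then have "p M q k \<in> near n (\<M> n) (F n)" using M(2) unfolding near_def by force
    then have "p M q k \<in> Q" using T(5) unfolding Q_def by blast
    moreover have "edist q M + ereal (1 / real (Suc k)) \<le> edist q M + ereal e"
      using k by (intro add_left_mono) simp
    ultimately show ?thesis using p[OF M(2), of q k] by (meson IntI order_trans)
  qed
  have dist_inter: "edist x (M \<inter> Y) = edist x M" if "M \<in> \<M> j" "x \<in> Y" for M j x
    using edist_inter_closure[of Q M x] Qnear[OF that(1)] that(2) unfolding Y_def by blast
  have limQ: "(\<lambda>n. edist x (C (\<alpha> n))) \<longlonglongrightarrow> edist x L" if x: "x \<in> Q" for x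
  \<comment> \<open>Stage \<open>n\<close> controls the index \<open>\<alpha> (Suc n)\<close>, hence
    the shift. A fixed \<open>x\<close> lies in \<open>F n\<close> from some stage on and is tested
    against \<open>N x n\<close> from then on.\<close>
  proof (rule LIMSEQ_imp_Suc, rule topological_tendstoI)
    fix S assume "open S" "edist x L \<in> S"
    then have "eventually (\<lambda>n. N x n \<subseteq> S) sequentially" by (rule N(3))
    moreover obtain i where "x \<in> F i" using x by (auto simp: Q_def)
    then have "eventually (\<lambda>n. x \<in> F n) sequentially"
      using Fmono unfolding eventually_sequentially by blast
    ultimately show "eventually (\<lambda>n. edist x (C (\<alpha> (Suc n))) \<in> S) sequentially"
      by eventually_elim (use T(6) in blast)
  qed
  have "wijsman_conv Y UNIV (\<le>) (\<lambda>n. C (\<alpha> n) \<inter> Y) (L \<inter> Y)"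
    unfolding wijsman_conv_def net_filter_nat
  proof
    fix y assume y: "y \<in> Y"
    have "(\<lambda>n. edist y (C (\<alpha> n))) \<longlonglongrightarrow> edist y L"
      using limQ y unfolding Y_def by (rule tendsto_edist_closure)
    \<comment> \<open>\<open>L\<close> and every \<open>C (\<alpha> n)\<close> belong to the family
      of sets, so their distances from \<open>y\<close> survive the intersection with
      \<open>Y\<close>.\<close>
    then show "(\<lambda>n. edist y (C (\<alpha> n) \<inter> Y)) \<longlonglongrightarrow> edist y (L \<inter> Y)"
      using dist_inter[OF P(2) y] dist_inter[OF P(3) y] by simp
  qed
  moreover have "closed_subspace Y"
  proof -
    have "Q \<noteq> {}" using P(6) by (auto simp: Q_def)
    then have "subspace Y" unfolding Y_def using Qcomb by (rule subspace_closure_rational)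
    then show ?thesis by (simp add: closed_subspace_def Y_def)
  qed
  moreover have "Y \<subseteq> E" unfolding Y_def using QE clE by (rule closure_minimal)
  moreover have "separable_space (top_of_set Y)"
  proof -
    have "countable Q" unfolding Q_def using P(4) by (simp add: countable_finite)
    moreover have "top_of_set Y closure_of Q = Y"
      using QY by (simp add: closure_of_subtopology_open Y_def)
    ultimately show ?thesis unfolding separable_space_def using QY by auto
  qed
  moreover have "h (\<alpha> n) \<subseteq> Y" for n using P(7)[of n] QY by (auto simp: Q_def)
  ultimately show ?thesis using P(1) T(1) by blast
qed

section \<open>Failure of slice and Mosco convergence\<close>

text \<open>Wijsman convergence at one nearly optimal \<open>v \<in> V\<close> bounds the set
  distances from above in the limit. Slice convergence can thus fail only from below: cofinally
  often the distance drops under a fixed \<open>r\<close>, and a pair of points shows it.\<close>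

lemma not_slice_conv_witness:
  assumes D: "directed_set D le" and W: "wijsman_conv E D le C L" and S: "\<not> slice_conv E D le C L"
  shows "\<exists>V r. V \<subseteq> E \<and> closed V \<and> bounded V \<and> convex V \<and> ereal r < esetdist V L \<and>
    (\<forall>a\<in>D. \<exists>b\<in>D. le a b \<and> (\<exists>v\<in>V. \<exists>c\<in>C b. dist v c < r))"
proof -
  obtain V where V: "V \<subseteq> E" "closed V" "bounded V" "convex V"
    and nlim: "\<not> ((\<lambda>a. esetdist V (C a)) \<longlongrightarrow> esetdist V L) (net_filter D le)"
    using S unfolding slice_conv_def by blast
  have upper: "eventually (\<lambda>a. esetdist V (C a) < b) (net_filter D le)"
    if b: "esetdist V L < b" for b
  proof -
    obtain v where v: "v \<in> V" "edist v L < b"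
      using b unfolding esetdist_edist INF_less_iff by blast
    then have "((\<lambda>a. edist v (C a)) \<longlongrightarrow> edist v L) (net_filter D le)"
      using W V(1) unfolding wijsman_conv_def by blast
    then have "eventually (\<lambda>a. edist v (C a) < b) (net_filter D le)"
      using v(2) by (rule order_tendstoD)
    then show ?thesis
      unfolding esetdist_edist INF_less_iff by eventually_elim (use v(1) in blast)
  qed
  obtain r0 where r0: "r0 < esetdist V L"
    and fr: "\<not> eventually (\<lambda>a. r0 < esetdist V (C a)) (net_filter D le)"
    using nlim upper order_tendstoI by metis
  obtain r where r: "r0 < ereal r" "ereal r < esetdist V L"
    using ereal_dense2[OF r0] by blast
  have "\<exists>b\<in>D. le a b \<and> (\<exists>v\<in>V. \<exists>c\<in>C b. dist v c < r)" if "a \<in> D" for a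
  proof -
    obtain b where b: "b \<in> D" "le a b" "\<not> r0 < esetdist V (C b)"
      using fr \<open>a \<in> D\<close> unfolding eventually_net_filter[OF D] by blast
    then have "esetdist V (C b) < ereal r" using r(1) by order
    then show ?thesis
      using b unfolding esetdist_def INF_less_iff by auto
  qed
  then show ?thesis using V r(2) by blast
qed

text \<open>The test set in \<open>Y\<close> is \<open>V \<inter> Y\<close>. The witness pairs lie
  in \<open>Y\<close> and keep its distances to the traces of the \<open>C (\<alpha> n)\<close> at
  most \<open>r\<close>, while intersecting with \<open>Y\<close> can only raise the distance of
  \<open>V\<close> to \<open>L\<close>, which exceeds \<open>r\<close>.\<close>

lemma separable_reduction_slice:
  fixes E :: "'a::real_normed_vector set" and C :: "'i \<Rightarrow> 'a set"
  assumes E: "closed_subspace E" and D: "directed_set D le"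
    and CE: "\<And>a. a \<in> D \<Longrightarrow> C a \<subseteq> E" and LE: "L \<subseteq> E"
    and W: "wijsman_conv E D le C L" and S: "\<not> slice_conv E D le C L"
  shows "\<exists>Y (\<alpha> :: nat \<Rightarrow> 'i). closed_subspace Y \<and> Y \<subseteq> E \<and> separable_space (top_of_set Y) \<and>
           (\<forall>n. \<alpha> n \<in> D \<and> le (\<alpha> n) (\<alpha> (Suc n))) \<and>
           wijsman_conv Y UNIV (\<le>) (\<lambda>n. C (\<alpha> n) \<inter> Y) (L \<inter> Y) \<and>
           \<not> slice_conv Y UNIV (\<le>) (\<lambda>n. C (\<alpha> n) \<inter> Y) (L \<inter> Y)"
proof -
  obtain V r where V: "V \<subseteq> E" "closed V" "bounded V" "convex V" "ereal r < esetdist V L"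
    and fr: "\<And>a. a \<in> D \<Longrightarrow> \<exists>b\<in>D. le a b \<and> (\<exists>v\<in>V. \<exists>c\<in>C b. dist v c < r)"
    using not_slice_conv_witness[OF D W S] by blast
  define G where "G = {b\<in>D. \<exists>v\<in>V. \<exists>c\<in>C b. dist v c < r}"
  have "\<forall>b. \<exists>v c. b \<in> G \<longrightarrow> v \<in> V \<and> c \<in> C b \<and> dist v c < r" unfolding G_def by blast
  then obtain v c where vc: "\<And>b. b \<in> G \<Longrightarrow> v b \<in> V \<and> c b \<in> C b \<and> dist (v b) (c b) < r"
    by metis
  have "\<exists>Y (\<alpha> :: nat \<Rightarrow> 'i). closed_subspace Y \<and> Y \<subseteq> E \<and> separable_space (top_of_set Y) \<and>
      (\<forall>n. \<alpha> n \<in> G \<and> le (\<alpha> n) (\<alpha> (Suc n)) \<and> {v (\<alpha> n), c (\<alpha> n)} \<subseteq> Y) \<and>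
      wijsman_conv Y UNIV (\<le>) (\<lambda>n. C (\<alpha> n) \<inter> Y) (L \<inter> Y)"
  proof (rule separable_reduction[OF E D CE LE W])
    show "G \<subseteq> D" by (auto simp: G_def)
    show "\<exists>b\<in>G. le a b" if "a \<in> D" for a using fr[OF that] unfolding G_def by blast
    show "finite {v a, c a} \<and> {v a, c a} \<subseteq> E" if "a \<in> G" for a
      using vc[OF that] V(1) CE[of a] that by (auto simp: G_def)
  qed
  then obtain Y \<alpha> where Y: "closed_subspace Y" "Y \<subseteq> E" "separable_space (top_of_set Y)"
    and \<alpha>: "\<And>n. \<alpha> n \<in> G" "\<And>n. le (\<alpha> n) (\<alpha> (Suc n))" "\<And>n. {v (\<alpha> n), c (\<alpha> n)} \<subseteq> Y"
    and WY: "wijsman_conv Y UNIV (\<le>) (\<lambda>n. C (\<alpha> n) \<inter> Y) (L \<inter> Y)"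
    by blast
  have "\<not> slice_conv Y UNIV (\<le>) (\<lambda>n. C (\<alpha> n) \<inter> Y) (L \<inter> Y)"
  proof
    assume "slice_conv Y UNIV (\<le>) (\<lambda>n. C (\<alpha> n) \<inter> Y) (L \<inter> Y)"
    moreover have "V \<inter> Y \<subseteq> Y \<and> closed (V \<inter> Y) \<and> bounded (V \<inter> Y) \<and> convex (V \<inter> Y)"
      using V Y(1) unfolding closed_subspace_def
      by (simp add: closed_Int bounded_Int convex_Int subspace_imp_convex)
    ultimately have "(\<lambda>n. esetdist (V \<inter> Y) (C (\<alpha> n) \<inter> Y)) \<longlonglongrightarrow> esetdist (V \<inter> Y) (L \<inter> Y)"
      unfolding slice_conv_def net_filter_nat by blast
    moreover have "esetdist (V \<inter> Y) (C (\<alpha> n) \<inter> Y) \<le> ereal r" for n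
    proof -
      have "esetdist (V \<inter> Y) (C (\<alpha> n) \<inter> Y) \<le> ereal (dist (v (\<alpha> n)) (c (\<alpha> n)))"
        using vc[OF \<alpha>(1)] \<alpha>(3)[of n] by (intro esetdist_le) auto
      also have "\<dots> \<le> ereal r" using vc[OF \<alpha>(1), of n] by simp
      finally show ?thesis .
    qed
    ultimately have "esetdist (V \<inter> Y) (L \<inter> Y) \<le> ereal r"
      by (intro LIMSEQ_le_const2) auto
    moreover have "esetdist V L \<le> esetdist (V \<inter> Y) (L \<inter> Y)" by (rule esetdist_antimono) auto
    ultimately show False using V(5) by order
  qed
  moreover have "\<alpha> n \<in> D" for n using \<alpha>(1)[of n] by (simp add: G_def)
  ultimately show ?thesis using Y \<alpha>(2) WY by blast
qed

section \<open>Failure of Mosco convergence\<close>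

text \<open>Under Wijsman convergence this leaves M(ii) as the only condition that can fail.\<close>

lemma wijsman_conv_imp_mosco_i:
  assumes "wijsman_conv E D le C L" "L \<subseteq> E"
  shows "mosco_i D le C L"
  unfolding mosco_i_def
proof
  fix y assume y: "y \<in> L"
  then have "((\<lambda>a. edist y (C a)) \<longlongrightarrow> edist y L) (net_filter D le)"
    using assms unfolding wijsman_conv_def by blast
  then show "((\<lambda>a. edist y (C a)) \<longlongrightarrow> 0) (net_filter D le)"
    by (simp add: edist_eq_0[OF y])
qed

text \<open>A functional \<open>f\<close> separates the limit \<open>l\<close> from
  \<open>L\<close>, and only subnet terms with \<open>f < r\<close> are kept. A sequence of them in
  \<open>Y\<close> inherits relative weak compactness, so M(ii) in \<open>Y\<close> would give it a
  weak cluster point in \<open>L\<close>, where \<open>f > r\<close>.\<close>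

lemma separable_reduction_mosco_ii:
  fixes E :: "'a::real_normed_vector set" and C :: "'i \<Rightarrow> 'a set"
  assumes E: "closed_subspace E" and D: "directed_set D le"
    and CE: "\<And>a. a \<in> D \<Longrightarrow> C a \<subseteq> E" and L: "L \<subseteq> E" "closed L" "convex L"
    and W: "wijsman_conv E D le C L" and M: "\<not> mosco_ii TYPE('b) E D le C L"
  shows "\<exists>Y (\<alpha> :: nat \<Rightarrow> 'i). closed_subspace Y \<and> Y \<subseteq> E \<and> separable_space (top_of_set Y) \<and>
           (\<forall>n. \<alpha> n \<in> D \<and> le (\<alpha> n) (\<alpha> (Suc n))) \<and>
           wijsman_conv Y UNIV (\<le>) (\<lambda>n. C (\<alpha> n) \<inter> Y) (L \<inter> Y) \<and>
           \<not> mosco_ii TYPE(nat \<times> 'a set) Y UNIV (\<le>) (\<lambda>n. C (\<alpha> n) \<inter> Y) (L \<inter> Y)"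
proof -
  obtain B :: "'b set" and leB \<phi> y l where sub: "subnet_map B leB \<phi> D le"
    and yC: "\<And>b. b \<in> B \<Longrightarrow> y b \<in> C (\<phi> b)" and rwc: "relatively_weakly_compact E (y ` B)"
    and lim: "limitin (weak_topology E) y l (net_filter B leB)" and l: "l \<notin> L"
    using M unfolding mosco_ii_def by blast
  have dir: "directed_set B leB" and \<phi>D: "\<phi> ` B \<subseteq> D"
    and cof: "\<And>a. a \<in> D \<Longrightarrow> \<exists>b0\<in>B. \<forall>b\<in>B. leB b0 b \<longrightarrow> le a (\<phi> b)"
    using sub by (auto simp: subnet_map_def)
  obtain f r where f: "f \<in> dual_on UNIV" "f l < r" "\<And>x. x \<in> L \<Longrightarrow> r < f x"
    using dual_on_separation[OF L(2,3) l] by blast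
  have lE: "l \<in> E" using lim by (simp add: limitin_def topspace_weak_topology)
  have "openin (weak_topology E) {x\<in>E. f x \<in> {..<r}}"
    by (intro openin_weak_topology_vimage dual_on_mono[OF f(1)]) auto
  then have "eventually (\<lambda>b. y b \<in> {x\<in>E. f x \<in> {..<r}}) (net_filter B leB)"
    using lim lE f(2) unfolding limitin_def by blast
  then obtain b1 where b1: "b1 \<in> B" "\<And>b. b \<in> B \<Longrightarrow> leB b1 b \<Longrightarrow> f (y b) < r"
    unfolding eventually_net_filter[OF dir] by auto
  \<comment> \<open>The original indices that carry a subnet term with \<open>f < r\<close>. As
    \<open>\<phi>\<close> may repeat values, \<open>g\<close> selects one position of the subnet for
    each.\<close>
  define G where "G = {\<phi> b | b. b \<in> B \<and> f (y b) < r}"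
  have "\<forall>i. \<exists>b. i \<in> G \<longrightarrow> b \<in> B \<and> f (y b) < r \<and> \<phi> b = i" unfolding G_def by blast
  then obtain g where g: "\<And>i. i \<in> G \<Longrightarrow> g i \<in> B \<and> f (y (g i)) < r \<and> \<phi> (g i) = i"
    by metis
  define z where "z i = y (g i)" for i
  have GD: "G \<subseteq> D" using \<phi>D by (auto simp: G_def)
  have zC: "z i \<in> C i" if "i \<in> G" for i using yC g[OF that] unfolding z_def by metis
  have "\<exists>Y (\<alpha> :: nat \<Rightarrow> 'i). closed_subspace Y \<and> Y \<subseteq> E \<and> separable_space (top_of_set Y) \<and>
      (\<forall>n. \<alpha> n \<in> G \<and> le (\<alpha> n) (\<alpha> (Suc n)) \<and> {z (\<alpha> n)} \<subseteq> Y) \<and>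
      wijsman_conv Y UNIV (\<le>) (\<lambda>n. C (\<alpha> n) \<inter> Y) (L \<inter> Y)"
  proof (rule separable_reduction[OF E D CE L(1) W GD])
    show "\<exists>b\<in>G. le a b" if a: "a \<in> D" for a
    proof -
      obtain b0 where b0: "b0 \<in> B" "\<And>b. b \<in> B \<Longrightarrow> leB b0 b \<Longrightarrow> le a (\<phi> b)"
        using cof[OF a] by blast
      \<comment> \<open>Above \<open>b0\<close> the index \<open>\<phi> b\<close> dominates
        \<open>a\<close>; above \<open>b1\<close> the term lies in the half-space.\<close>
      obtain b where "b \<in> B" "leB b0 b" "leB b1 b"
        using dir b0(1) b1(1) unfolding directed_set_def by blast
      then show ?thesis using b0(2) b1(2) unfolding G_def by blast
    qed
    show "finite {z a} \<and> {z a} \<subseteq> E" if "a \<in> G" for a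
      using zC[OF that] CE[of a] GD that by auto
  qed
  then obtain Y \<alpha> where Y: "closed_subspace Y" "Y \<subseteq> E" "separable_space (top_of_set Y)"
    and \<alpha>: "\<And>n. \<alpha> n \<in> G" "\<And>n. le (\<alpha> n) (\<alpha> (Suc n))" "\<And>n. z (\<alpha> n) \<in> Y"
    and WY: "wijsman_conv Y UNIV (\<le>) (\<lambda>n. C (\<alpha> n) \<inter> Y) (L \<inter> Y)"
    by blast
  have "\<not> mosco_ii TYPE(nat \<times> 'a set) Y UNIV (\<le>) (\<lambda>n. C (\<alpha> n) \<inter> Y) (L \<inter> Y)"
  proof
    assume MY: "mosco_ii TYPE(nat \<times> 'a set) Y UNIV (\<le>) (\<lambda>n. C (\<alpha> n) \<inter> Y) (L \<inter> Y)"
    have "range (\<lambda>n. z (\<alpha> n)) \<subseteq> y ` B \<inter> Y"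
      using g[OF \<alpha>(1)] \<alpha>(3) unfolding z_def by blast
    note rwcY = relatively_weakly_compact_subspace[OF Y(1,2) rwc this]
    obtain l' where l': "l' \<in> L" "l' \<in> weak_topology Y closure_of range (\<lambda>n. z (\<alpha> n))"
      using mosco_ii_sequence_cluster[OF MY _ rwcY] zC[OF \<alpha>(1)] \<alpha>(3) by blast
    \<comment> \<open>The opposite half-space is a weak neighbourhood of \<open>l'\<close>, so it
      would contain a term of the sequence.\<close>
    have "openin (weak_topology Y) {x\<in>Y. f x \<in> {r<..}}"
      by (intro openin_weak_topology_vimage dual_on_mono[OF f(1)]) auto
    moreover have "l' \<in> {x\<in>Y. f x \<in> {r<..}}"
      using l' f(3) by (auto simp: closure_of_def topspace_weak_topology)
    ultimately have "\<exists>w\<in>range (\<lambda>n. z (\<alpha> n)). w \<in> {x\<in>Y. f x \<in> {r<..}}"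
      using l'(2)[unfolded in_closure_of, THEN conjunct2, rule_format, of "{x\<in>Y. f x \<in> {r<..}}"]
      by metis
    then obtain n where "f (z (\<alpha> n)) > r" by auto
    then show False using g[OF \<alpha>(1), of n] by (simp add: z_def)
  qed
  moreover have "\<alpha> n \<in> D" for n using \<alpha>(1)[of n] GD by blast
  ultimately show ?thesis using Y \<alpha>(2) WY by blast
qed

theorem theorem2p2:
  fixes E :: "'a::banach set"
    and D :: "'i set" and le :: "'i \<Rightarrow> 'i \<Rightarrow> bool"
    and C :: "'i \<Rightarrow> 'a set" and L :: "'a set"
  assumes "infinite_dimensional TYPE('a)"
    and "closed_subspace E"
    and "directed_set D le"
    and "\<And>a. a \<in> D \<Longrightarrow> C a \<subseteq> E \<and> closed (C a) \<and> convex (C a)"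
    and "L \<subseteq> E" and "closed L" and "convex L"
    and "wijsman_conv E D le C L"
  shows "(\<not> slice_conv E D le C L \<longrightarrow>
           (\<exists>Y (\<alpha> :: nat \<Rightarrow> 'i).
              closed_subspace Y \<and> Y \<subseteq> E \<and> separable_space (top_of_set Y) \<and>
              (\<forall>n. \<alpha> n \<in> D \<and> le (\<alpha> n) (\<alpha> (Suc n))) \<and>
              wijsman_conv Y UNIV (\<le>) (\<lambda>n. C (\<alpha> n) \<inter> Y) (L \<inter> Y) \<and>
              \<not> slice_conv Y UNIV (\<le>) (\<lambda>n. C (\<alpha> n) \<inter> Y) (L \<inter> Y)))
       \<and> (\<not> mosco_conv E D le C L \<longrightarrow>
           (\<exists>Y (\<alpha> :: nat \<Rightarrow> 'i).
              closed_subspace Y \<and> Y \<subseteq> E \<and> separable_space (top_of_set Y) \<and>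
              (\<forall>n. \<alpha> n \<in> D \<and> le (\<alpha> n) (\<alpha> (Suc n))) \<and>
              wijsman_conv Y UNIV (\<le>) (\<lambda>n. C (\<alpha> n) \<inter> Y) (L \<inter> Y) \<and>
              \<not> mosco_conv Y UNIV (\<le>) (\<lambda>n. C (\<alpha> n) \<inter> Y) (L \<inter> Y)))"
proof (intro conjI impI)
  have CE: "\<And>a. a \<in> D \<Longrightarrow> C a \<subseteq> E" using assms(4) by blast
  show "\<exists>Y (\<alpha> :: nat \<Rightarrow> 'i).
      closed_subspace Y \<and> Y \<subseteq> E \<and> separable_space (top_of_set Y) \<and>
      (\<forall>n. \<alpha> n \<in> D \<and> le (\<alpha> n) (\<alpha> (Suc n))) \<and>
      wijsman_conv Y UNIV (\<le>) (\<lambda>n. C (\<alpha> n) \<inter> Y) (L \<inter> Y) \<and>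
      \<not> slice_conv Y UNIV (\<le>) (\<lambda>n. C (\<alpha> n) \<inter> Y) (L \<inter> Y)"
    if "\<not> slice_conv E D le C L"
    by (rule separable_reduction_slice[OF assms(2,3) CE assms(5,8) that])
  show "\<exists>Y (\<alpha> :: nat \<Rightarrow> 'i).
      closed_subspace Y \<and> Y \<subseteq> E \<and> separable_space (top_of_set Y) \<and>
      (\<forall>n. \<alpha> n \<in> D \<and> le (\<alpha> n) (\<alpha> (Suc n))) \<and>
      wijsman_conv Y UNIV (\<le>) (\<lambda>n. C (\<alpha> n) \<inter> Y) (L \<inter> Y) \<and>
      \<not> mosco_conv Y UNIV (\<le>) (\<lambda>n. C (\<alpha> n) \<inter> Y) (L \<inter> Y)"
    if "\<not> mosco_conv E D le C L"
  proof -
    have "\<not> mosco_ii TYPE(('i \<times> 'a) \<times> ('i \<times> 'a) set) E D le C L"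
      using that wijsman_conv_imp_mosco_i[OF assms(8,5)] unfolding mosco_conv_def by blast
    \<comment> \<open>In \<open>Y\<close> the failure is obtained for subnets indexed by
      \<open>nat \<times> 'a set\<close>; it carries over to the index type of
      \<open>mosco_conv\<close>, whose instance implies every other one.\<close>
    from separable_reduction_mosco_ii[OF assms(2,3) CE assms(5-8) this]
    show ?thesis
      unfolding mosco_conv_def using mosco_ii_any_index_type by blast
  qed
qed

end
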